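(* Let $M$ be a finitely presented special monoid. Let $\mathcal{C}$ be a super-AFL closed under reversal. Then $M$ has word problem in $\mathcal{C}$ if and only if the group of units $U(M)$ of $M$ has word problem in $\mathcal{C}$.
   Context: A monoid is special if it admits a monoid presentation in which every defining relation is of the form $w=1$; a finitely presented special monoid is one given by a finite presentation $\langle A \mid w_1=1,\dots,w_k=1\rangle$ (with $A$ finite). $U(M)$ is the group of all two-sided invertible elements of $M$. Word problem: for a word $w=a_1a_2\cdots a_n$, $w^{\mathrm{rev}}=a_n\cdots a_2a_1$. For a monoid $M$ generated (as a monoid) by a finite set $A$, write $u=_M v$ if $u,v\in A^*$ represent the same element of $M$, and let $\mathrm{WP}_A^M=\{u\# v^{\mathrm{rev}} \mid u,v\in A^*,\ u=_M v\}$, where $\#\notin A$. $M$ has word problem in $\mathcal{C}$ if $\mathrm{WP}_A^M\in\mathcal{C}$; if $\mathcal{C}$ is closed under inverse homomorphism this does not depend on the choice of finite generating set $A$. Super-AFL: a class $\mathcal{C}$ of languages (over finite alphabets) is an AFL if it is closed under homomorphism, inverse homomorphism, intersection with regular languages, union, concatenation, and Kleene star. It is a super-AFL if in addition it is closed under nested iterated substitution, defined as follows. A $\mathcal{C}$-substitution $\sigma$ on a finite alphabet $A$ assigns to each $a\in A$ a language $\sigma(a)\in\mathcal{C}$ (over any finite alphabet), extended by $\sigma(xy)=\sigma(x)\sigma(y)$ and $\sigma(L)=\bigcup_{w\in L}\sigma(w)$. Let $A_a$ be the smallest finite alphabet with $\sigma(a)\subseteq A_a^*$, and extend $\sigma$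 to $A\cup\bigcup_a A_a$ by $\sigma(b)=\{b\}$ for $b\in(\bigcup_a A_a)\setminus A$. Put $\sigma^0(L)=L$, $\sigma^{n+1}(L)=\sigma(\sigma^n(L))$, $\sigma^\infty(L)=\bigcup_{n\ge0}\sigma^n(L)$. The iterated substitution $\sigma^\infty$ is nested if $b\in\sigma(b)$ for every $b\in A\cup\bigcup_a A_a$. $\mathcal{C}$ is closed under nested iterated substitution if $\sigma^\infty(L)\in\mathcal{C}$ for every $\mathcal{C}$-substitution $\sigma$ on $A$ with $\sigma^\infty$ nested and every $L\in\mathcal{C}$, $L\subseteq A^*$. $\mathcal{C}$ is closed under reversal if $L\in\mathcal{C}$ implies $\{w^{\mathrm{rev}}\mid w\in L\}\in\mathcal{C}$. *)

theory Defs
  imports "HOL-Algebra.Group"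
begin

section \<open>Classes of languages\<close>

text \<open>
  Letters are drawn from the fixed countably infinite supply \<^typ>\<open>nat\<close>; an alphabet is a
  finite subset of it, and a class of languages is a set of type \<^typ>\<open>nat list set set\<close>
  each of whose members is a language over some finite alphabet.
\<close>

definition language_class :: "nat list set set \<Rightarrow> bool" where
  "language_class C \<longleftrightarrow> (\<forall>L\<in>C. \<exists>A. finite A \<and> L \<subseteq> lists A)"

definition conc :: "'a list set \<Rightarrow> 'a list set \<Rightarrow> 'a list set" where
  "conc K L = {u @ v | u v. u \<in> K \<and> v \<in> L}"

definition kstar :: "'a list set \<Rightarrow> 'a list set" where
  "kstar L = concat ` lists L"

text \<open>The homomorphism of free monoids extending a map from letters to words.\<close>

definition word_hom :: "('a \<Rightarrow> 'b list) \<Rightarrow> 'a list \<Rightarrow> 'b list" where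
  "word_hom f w = concat (map f w)"

text \<open>Regular languages: recognised by a deterministic finite automaton with state set \<open>Q\<close>,
  initial state \<open>q0\<close>, final states \<open>F\<close> and transition function \<open>d\<close>.\<close>

definition regular_language :: "nat list set \<Rightarrow> bool" where
  "regular_language R \<longleftrightarrow>
     (\<exists>A (Q :: nat set) q0 F d. finite A \<and> finite Q \<and> q0 \<in> Q \<and> F \<subseteq> Q \<and>
        (\<forall>q\<in>Q. \<forall>a\<in>A. d q a \<in> Q) \<and> R = {w \<in> lists A. foldl d q0 w \<in> F})"

text \<open>Homomorphisms may erase letters. Since every member of a class is a language over some finite
  alphabet, only the values of \<open>f\<close> on finitely many letters matter for the image, whereas for the
  preimage the domain alphabet \<open>A\<close> has to be named.\<close>

definition afl :: "nat list set set \<Rightarrow> bool" where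
  "afl C \<longleftrightarrow> language_class C \<and>
     (\<forall>L\<in>C. \<forall>f. word_hom f ` L \<in> C) \<and>
     (\<forall>L\<in>C. \<forall>A f. finite A \<longrightarrow> {w \<in> lists A. word_hom f w \<in> L} \<in> C) \<and>
     (\<forall>L\<in>C. \<forall>R. regular_language R \<longrightarrow> L \<inter> R \<in> C) \<and>
     (\<forall>K\<in>C. \<forall>L\<in>C. K \<union> L \<in> C) \<and>
     (\<forall>K\<in>C. \<forall>L\<in>C. conc K L \<in> C) \<and>
     (\<forall>L\<in>C. kstar L \<in> C)"

primrec subst_word :: "('a \<Rightarrow> 'b list set) \<Rightarrow> 'a list \<Rightarrow> 'b list set" where
  "subst_word s [] = {[]}"
| "subst_word s (a # w) = conc (s a) (subst_word s w)"

definition subst_lang :: "('a \<Rightarrow> 'b list set) \<Rightarrow> 'a list set \<Rightarrow> 'b list set" where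
  "subst_lang s L = (\<Union>w\<in>L. subst_word s w)"

text \<open>A substitution on \<open>A\<close> is given by the values \<open>s a\<close> for \<open>a \<in> A\<close>; it is extended by
  \<open>b \<mapsto> {b}\<close> to all other letters.\<close>

definition ext_subst :: "'a set \<Rightarrow> ('a \<Rightarrow> 'a list set) \<Rightarrow> 'a \<Rightarrow> 'a list set" where
  "ext_subst A s b = (if b \<in> A then s b else {[b]})"

definition letters :: "'a list set \<Rightarrow> 'a set" where
  "letters L = (\<Union>w\<in>L. set w)"

definition nested_subst :: "'a set \<Rightarrow> ('a \<Rightarrow> 'a list set) \<Rightarrow> bool" where
  "nested_subst A s \<longleftrightarrow> (\<forall>b \<in> A \<union> (\<Union>a\<in>A. letters (s a)). [b] \<in> ext_subst A s b)"

definition iterated_subst :: "'a set \<Rightarrow> ('a \<Rightarrow> 'a list set) \<Rightarrow> 'a list set \<Rightarrow> 'a list set" where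
  "iterated_subst A s L = (\<Union>n. (subst_lang (ext_subst A s) ^^ n) L)"

definition closed_nested_iterated_subst :: "nat list set set \<Rightarrow> bool" where
  "closed_nested_iterated_subst C \<longleftrightarrow>
     (\<forall>A s L. finite A \<and> (\<forall>a\<in>A. s a \<in> C) \<and> nested_subst A s \<and> L \<in> C \<and> L \<subseteq> lists A
        \<longrightarrow> iterated_subst A s L \<in> C)"

definition super_afl :: "nat list set set \<Rightarrow> bool" where
  "super_afl C \<longleftrightarrow> afl C \<and> closed_nested_iterated_subst C"

definition closed_reversal :: "nat list set set \<Rightarrow> bool" where
  "closed_reversal C \<longleftrightarrow> (\<forall>L\<in>C. rev ` L \<in> C)"


section \<open>Monoid presentations\<close>

text \<open>The least congruence on the free monoid over \<open>A\<close> containing \<open>R\<close>, for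
  \<open>R \<subseteq> lists A \<times> lists A\<close>.\<close>

inductive_set pres_cong :: "'a set \<Rightarrow> ('a list \<times> 'a list) set \<Rightarrow> ('a list \<times> 'a list) set"
  for A R where
  rel: "(u, v) \<in> R \<Longrightarrow> u \<in> lists A \<Longrightarrow> v \<in> lists A \<Longrightarrow> (u, v) \<in> pres_cong A R"
| refl: "u \<in> lists A \<Longrightarrow> (u, u) \<in> pres_cong A R"
| sym: "(u, v) \<in> pres_cong A R \<Longrightarrow> (v, u) \<in> pres_cong A R"
| trans: "(u, v) \<in> pres_cong A R \<Longrightarrow> (v, w) \<in> pres_cong A R \<Longrightarrow> (u, w) \<in> pres_cong A R"
| mult: "(u, v) \<in> pres_cong A R \<Longrightarrow> (u', v') \<in> pres_cong A R \<Longrightarrow> (u @ u', v @ v') \<in> pres_cong A R"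

definition presented_monoid :: "'a set \<Rightarrow> ('a list \<times> 'a list) set \<Rightarrow> 'a list set monoid" where
  "presented_monoid A R =
     \<lparr>carrier = lists A // pres_cong A R,
      mult = (\<lambda>X Y. \<Union>x\<in>X. \<Union>y\<in>Y. pres_cong A R `` {x @ y}),
      one = pres_cong A R `` {[]}\<rparr>"

lemma pres_cong_in_lists:
  "(u, v) \<in> pres_cong A R \<Longrightarrow> u \<in> lists A \<and> v \<in> lists A"
  by (induction rule: pres_cong.induct) auto

lemma equiv_pres_cong: "equiv (lists A) (pres_cong A R)"
proof (rule equivI)
  show "pres_cong A R \<subseteq> lists A \<times> lists A"
    by (rule subrelI) (metis SigmaI pres_cong_in_lists)
  show "refl_on (lists A) (pres_cong A R)"
    by (rule refl_onI) (rule pres_cong.refl)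
  show "Relation.sym (pres_cong A R)"
    by (rule symI) (rule pres_cong.sym)
  show "Relation.trans (pres_cong A R)"
    by (rule transI) (rule pres_cong.trans)
qed

lemma presented_monoid_mult:
  assumes "u \<in> lists A" "v \<in> lists A"
  shows "pres_cong A R `` {u} \<otimes>\<^bsub>presented_monoid A R\<^esub> pres_cong A R `` {v} = pres_cong A R `` {u @ v}"
proof -
  have *: "pres_cong A R `` {x @ y} = pres_cong A R `` {u @ v}"
    if "x \<in> pres_cong A R `` {u}" "y \<in> pres_cong A R `` {v}" for x y
  proof -
    have "(u @ v, x @ y) \<in> pres_cong A R"
      using that by (intro pres_cong.mult) simp_all
    then show ?thesis
      by (rule equiv_class_eq[OF equiv_pres_cong, symmetric])
  qed
  have "u \<in> pres_cong A R `` {u}" "v \<in> pres_cong A R `` {v}"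
    using assms by (simp_all add: pres_cong.refl)
  then have "(\<Union>x\<in>pres_cong A R `` {u}. \<Union>y\<in>pres_cong A R `` {v}. pres_cong A R `` {u @ v})
      = pres_cong A R `` {u @ v}"
    by (simp only: UN_constant) auto
  then show ?thesis
    by (simp add: presented_monoid_def * cong: SUP_cong_simp)
qed

lemma monoid_presented_monoid: "monoid (presented_monoid A R)"
proof -
  let ?P = "presented_monoid A R"
  have carr: "carrier ?P = lists A // pres_cong A R" and one: "\<one>\<^bsub>?P\<^esub> = pres_cong A R `` {[]}"
    by (simp_all add: presented_monoid_def)
  have cls: "pres_cong A R `` {u} \<in> carrier ?P" if "u \<in> lists A" for u
    unfolding carr using that by (rule quotientI)
  have rep: "\<exists>u\<in>lists A. X = pres_cong A R `` {u}" if "X \<in> carrier ?P" for X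
    using that unfolding carr by (auto elim: quotientE)
  show ?thesis
  proof (rule monoidI)
    show "\<one>\<^bsub>?P\<^esub> \<in> carrier ?P"
      unfolding one by (rule cls) simp
  next
    fix X Y assume "X \<in> carrier ?P" "Y \<in> carrier ?P"
    then obtain u v where "u \<in> lists A" "v \<in> lists A"
      "X = pres_cong A R `` {u}" "Y = pres_cong A R `` {v}" using rep by metis
    then show "X \<otimes>\<^bsub>?P\<^esub> Y \<in> carrier ?P"
      using cls[of "u @ v"] by (simp add: presented_monoid_mult)
  next
    fix X Y Z assume "X \<in> carrier ?P" "Y \<in> carrier ?P" "Z \<in> carrier ?P"
    then obtain u v w where "u \<in> lists A" "v \<in> lists A" "w \<in> lists A"
      "X = pres_cong A R `` {u}" "Y = pres_cong A R `` {v}" "Z = pres_cong A R `` {w}"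
      using rep by metis
    then show "X \<otimes>\<^bsub>?P\<^esub> Y \<otimes>\<^bsub>?P\<^esub> Z = X \<otimes>\<^bsub>?P\<^esub> (Y \<otimes>\<^bsub>?P\<^esub> Z)"
      by (simp add: presented_monoid_mult)
  next
    fix X assume "X \<in> carrier ?P"
    then obtain u where "u \<in> lists A" "X = pres_cong A R `` {u}" using rep by metis
    then show "\<one>\<^bsub>?P\<^esub> \<otimes>\<^bsub>?P\<^esub> X = X" "X \<otimes>\<^bsub>?P\<^esub> \<one>\<^bsub>?P\<^esub> = X"
      by (simp_all add: one presented_monoid_mult)
  qed
qed

definition fp_special_monoid :: "('m, 'b) monoid_scheme \<Rightarrow> bool" where
  "fp_special_monoid M \<longleftrightarrow> monoid M \<and>
     (\<exists>(A :: nat set) W. finite A \<and> finite W \<and> W \<subseteq> lists A \<and>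
        M \<cong> presented_monoid A (W \<times> {[]}))"


section \<open>Word problems\<close>

definition word_eval :: "('m, 'b) monoid_scheme \<Rightarrow> ('a \<Rightarrow> 'm) \<Rightarrow> 'a list \<Rightarrow> 'm" where
  "word_eval M p w = foldr (\<lambda>a x. p a \<otimes>\<^bsub>M\<^esub> x) w \<one>\<^bsub>M\<^esub>"

definition generating_map :: "('m, 'b) monoid_scheme \<Rightarrow> 'a set \<Rightarrow> ('a \<Rightarrow> 'm) \<Rightarrow> bool" where
  "generating_map M A p \<longleftrightarrow> p \<in> A \<rightarrow> carrier M \<and> word_eval M p ` lists A = carrier M"

text \<open>Here \<open>h\<close> plays the role of the separator \<open>#\<close>.\<close>

definition word_problem :: "('m, 'b) monoid_scheme \<Rightarrow> 'a set \<Rightarrow> ('a \<Rightarrow> 'm) \<Rightarrow> 'a \<Rightarrow> 'a list set" where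
  "word_problem M A p h =
     {u @ [h] @ rev v | u v. u \<in> lists A \<and> v \<in> lists A \<and> word_eval M p u = word_eval M p v}"

text \<open>A generating set is an alphabet \<open>A\<close> together with its interpretation \<open>p\<close> in the monoid
  (not required to be injective). For the classes considered here membership depends neither on
  the choice of \<open>A\<close> and \<open>p\<close> nor on that of \<open>h\<close>. A monoid that is not finitely generated
  does not have word problem in any class.\<close>

definition has_word_problem_in :: "('m, 'b) monoid_scheme \<Rightarrow> nat list set set \<Rightarrow> bool" where
  "has_word_problem_in M C \<longleftrightarrow>
     (\<exists>A p h. finite A \<and> generating_map M A p \<and> h \<notin> A \<and> word_problem M A p h \<in> C)"

end

theory Submission
  imports Defs "HOL-Library.Countable_Set"
begin

text \<open>
  Adjoin all units of \<open>M = \<langle>A | W\<rangle>\<close> as letters and rewrite any unit-valued factor that either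
  consists of such letters or arises from a word over \<open>A\<close> of at most relator length by contracting
  unit factors, to the letter of its value (nothing for the identity). If \<open>xy\<close> and \<open>yz\<close> are units
  then so are \<open>x\<close>, \<open>y\<close> and \<open>z\<close>, which makes this terminating system confluent; in the spirit of
  Zhang's rewriting system, two words over \<open>A\<close> are equal in \<open>M\<close> iff they have a common reduct.

  Since every unit-valued word over \<open>A\<close> reduces to a single letter, the units are generated by the
  finitely many units of words of at most relator length, and the word problem of \<open>U(M)\<close> is an
  inverse homomorphic image of that of \<open>M\<close>. Conversely, read backwards the reductions become a
  grammar on letters \<open>z\<close> for these generators: \<open>z\<close> produces every word over the generators with the
  same value and finitely many further words over \<open>A\<close> and the generators; the separator produces
  \<open>u # v\<^sup>r\<^sup>e\<^sup>v\<close> with \<open>u = v\<close> in \<open>U(M)\<close>, and \<open>a # a\<close> for \<open>a \<in> A\<close>. This is a nested iterated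
  substitution in terms of the word problem of \<open>U(M)\<close>, and its words over \<open>A\<close> and \<open>#\<close> form the word
  problem of \<open>M\<close>.
\<close>

section \<open>Languages\<close>

lemma word_hom_simps [simp]:
  "word_hom f [] = []"
  "word_hom f (a # w) = f a @ word_hom f w"
  "word_hom f (u @ v) = word_hom f u @ word_hom f v"
  by (simp_all add: word_hom_def)

lemma word_hom_in_lists:
  assumes "f \<in> Z \<rightarrow> lists B" and "u \<in> lists Z"
  shows "word_hom f u \<in> lists B"
  using assms(2) by induction (use assms(1) in auto)

lemma separated_eq_iff:
  assumes "h \<notin> set u" "h \<notin> set u'" "h \<notin> set v" "h \<notin> set v'"
  shows "u @ [h] @ v = u' @ [h] @ v' \<longleftrightarrow> u = u' \<and> v = v'"
  using assms by (auto simp: append_eq_append_conv2 append_eq_Cons_conv Cons_eq_append_conv)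

text \<open>Since \<open>h\<close> lies outside \<open>A\<close>, a word
  \<open>u @ [h] @ rev v\<close> has only one such decomposition. Membership is therefore a genuine
  test of equality and not just a consequence of it.\<close>

lemma word_problem_iff:
  assumes "h \<notin> A" "u \<in> lists A" "v \<in> lists A"
  shows "u @ [h] @ rev v \<in> word_problem G A p h \<longleftrightarrow> word_eval G p u = word_eval G p v"
proof
  assume "u @ [h] @ rev v \<in> word_problem G A p h"
  then obtain u' v' where *: "u @ [h] @ rev v = u' @ [h] @ rev v'" "u' \<in> lists A" "v' \<in> lists A"
    "word_eval G p u' = word_eval G p v'"
    by (auto simp: word_problem_def)
  then have "u = u' \<and> rev v = rev v'"
    using assms by (subst (asm) separated_eq_iff) auto
  with * show "word_eval G p u = word_eval G p v" by simp
qed (use assms in \<open>auto simp: word_problem_def\<close>)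

lemma regular_language_separated:
  assumes "finite X" "finite Y" "k \<notin> X" "k \<notin> Y"
  shows "regular_language {u @ [k] @ v | u v. u \<in> lists X \<and> v \<in> lists Y}"
proof -
  \<comment> \<open>State 0 reads the part before the separator, state 1 the part after it, and
    state 2 is a sink for malformed words.\<close>
  define d :: "nat \<Rightarrow> nat \<Rightarrow> nat" where "d q a = (if q = 0 \<and> a \<in> X then 0 else if q = 0 \<and> a = k then 1
    else if q = 1 \<and> a \<in> Y then 1 else 2)" for q a
  have d2: "foldl d 2 w = 2" for w
    by (induction w) (auto simp: d_def)
  have d1: "foldl d 1 w = 1 \<longleftrightarrow> w \<in> lists Y" for w
    using d2 by (induction w) (auto simp: d_def)
  have d0: "foldl d 0 w = 1 \<longleftrightarrow> (\<exists>u v. w = u @ [k] @ v \<and> u \<in> lists X \<and> v \<in> lists Y)" for w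
  proof (induction w)
    case (Cons a w)
    consider "a \<in> X" | "a = k" | "a \<notin> X" "a \<noteq> k" by auto
    then show ?case
    proof cases
      case 1
      then have "foldl d 0 (a # w) = foldl d 0 w" by (simp add: d_def)
      moreover have "(\<exists>u v. a # w = u @ [k] @ v \<and> u \<in> lists X \<and> v \<in> lists Y) \<longleftrightarrow>
          (\<exists>u v. w = u @ [k] @ v \<and> u \<in> lists X \<and> v \<in> lists Y)" (is "?l \<longleftrightarrow> ?r")
      proof
        assume ?l
        then obtain u v where "a # w = u @ [k] @ v" "u \<in> lists X" "v \<in> lists Y" by blast
        with 1 assms(3) have "w = tl u @ [k] @ v \<and> tl u \<in> lists X \<and> v \<in> lists Y"
          by (cases u) auto
        then show ?r by blast
      next
        assume ?r
        then obtain u v where "w = u @ [k] @ v" "u \<in> lists X" "v \<in> lists Y" by blast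
        with 1 have "a # w = (a # u) @ [k] @ v \<and> a # u \<in> lists X \<and> v \<in> lists Y" by simp
        then show ?l by blast
      qed
      ultimately show ?thesis using Cons by simp
    next
      case 2
      then have "foldl d 0 (a # w) = foldl d 1 w" using assms by (simp add: d_def)
      with d1 2 assms show ?thesis by (auto simp: Cons_eq_append_conv)
    next
      case 3
      then have "foldl d 0 (a # w) = foldl d 2 w" by (simp add: d_def)
      with d2 3 show ?thesis by (auto simp: Cons_eq_append_conv)
    qed
  qed simp
  show ?thesis
    unfolding regular_language_def
    by (rule exI[of _ "insert k (X \<union> Y)"], rule exI[of _ "{0, 1, 2}"], rule exI[of _ 0],
        rule exI[of _ "{1}"], rule exI[of _ d])
      (use assms d0 in \<open>auto simp: d_def\<close>)
qed

section \<open>Constructions inside an AFL\<close>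

context
  fixes C :: "nat list set set"
  assumes afl: "afl C"
begin

lemma afl_hom: "L \<in> C \<Longrightarrow> word_hom f ` L \<in> C"
  and afl_inverse_hom: "L \<in> C \<Longrightarrow> finite X \<Longrightarrow> {w \<in> lists X. word_hom f w \<in> L} \<in> C"
  and afl_Int_regular: "L \<in> C \<Longrightarrow> regular_language R \<Longrightarrow> L \<inter> R \<in> C"
  and afl_Un: "K \<in> C \<Longrightarrow> L \<in> C \<Longrightarrow> K \<union> L \<in> C"
  and afl_conc: "K \<in> C \<Longrightarrow> L \<in> C \<Longrightarrow> conc K L \<in> C"
  and afl_kstar: "L \<in> C \<Longrightarrow> kstar L \<in> C"
  using afl by (simp_all add: afl_def)

text \<open>Inverse homomorphism followed by intersection with a regular language. The separator
  \<open>k\<close> may be sent to any word, so the image can carry extra material in the middle or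
  no separator at all.\<close>

lemma afl_separated:
  assumes "L \<in> C" "finite X" "finite Y" "k \<notin> X" "k \<notin> Y"
  shows "{u @ [k] @ v | u v. u \<in> lists X \<and> v \<in> lists Y \<and>
           word_hom f u @ f k @ word_hom f v \<in> L} \<in> C" (is "?S \<in> C")
proof -
  let ?D = "insert k (X \<union> Y)"
  have "{w \<in> lists ?D. word_hom f w \<in> L} \<in> C"
    using assms by (intro afl_inverse_hom) auto
  then have "{w \<in> lists ?D. word_hom f w \<in> L} \<inter>
      {u @ [k] @ v | u v. u \<in> lists X \<and> v \<in> lists Y} \<in> C"
    by (rule afl_Int_regular) (rule regular_language_separated[OF assms(2-5)])
  also have "{w \<in> lists ?D. word_hom f w \<in> L} \<inter>
      {u @ [k] @ v | u v. u \<in> lists X \<and> v \<in> lists Y} = ?S"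
  proof (intro equalityI subsetI)
    fix w assume "w \<in> ?S"
    then obtain u v where w: "w = u @ [k] @ v" "u \<in> lists X" "v \<in> lists Y"
      "word_hom f u @ f k @ word_hom f v \<in> L" by blast
    then have "w \<in> lists ?D" by auto
    moreover have "word_hom f w \<in> L" using w by simp
    ultimately show "w \<in> {w \<in> lists ?D. word_hom f w \<in> L} \<inter>
      {u @ [k] @ v | u v. u \<in> lists X \<and> v \<in> lists Y}" using w by blast
  next
    fix w assume "w \<in> {w \<in> lists ?D. word_hom f w \<in> L} \<inter>
      {u @ [k] @ v | u v. u \<in> lists X \<and> v \<in> lists Y}"
    then obtain u v where w: "w = u @ [k] @ v" "u \<in> lists X" "v \<in> lists Y" "word_hom f w \<in> L"
      by blast
    then show "w \<in> ?S" by simp blast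
  qed
  finally show ?thesis .
qed

lemma afl_map:
  assumes "L \<in> C"
  shows "map f ` L \<in> C"
proof -
  have "word_hom (\<lambda>a. [f a]) w = map f w" for w
    by (induction w) auto
  then show ?thesis
    using afl_hom[OF assms, of "\<lambda>a. [f a]"] by simp
qed

text \<open>The empty class satisfies \<open>afl\<close>, so some member is required to start from.
  Intersecting it with the empty regular language leaves nothing.\<close>

lemma afl_empty_language:
  assumes "C \<noteq> {}"
  shows "{} \<in> C"
proof -
  have "regular_language {}"
    unfolding regular_language_def
    by (rule exI[of _ "{}"], rule exI[of _ "{0}"], rule exI[of _ 0], rule exI[of _ "{}"]) auto
  then show ?thesis
    using assms afl_Int_regular by (metis ex_in_conv inf_bot_right)
qed

lemma afl_singleton:
  assumes "C \<noteq> {}"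
  shows "{w} \<in> C"
proof -
  have eps: "{[]} \<in> C"
    using afl_kstar[OF afl_empty_language[OF assms]] by (simp add: kstar_def)
  have "{[a]} \<in> C" for a
    \<comment> \<open>The preimage of \<open>{[]}\<close> under the erasing homomorphism, with empty
      alphabets on both sides of the separator \<open>a\<close>, consists of \<open>[a]\<close>
      alone.\<close>
    using afl_separated[OF eps, of "{}" "{}" a "\<lambda>_. []"] by simp
  then show ?thesis
  proof (induction w)
    case (Cons a w)
    have "conc {[a]} {w} = {a # w}" by (auto simp: conc_def)
    then show ?case using afl_conc[of "{[a]}" "{w}"] Cons by simp
  qed (rule eps)
qed

lemma afl_finite:
  assumes "C \<noteq> {}" "finite L"
  shows "L \<in> C"
  using assms(2)
proof induction
  case (insert w L)
  then show ?case using afl_Un[OF afl_singleton[OF assms(1)], of L w] by simp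
qed (rule afl_empty_language[OF assms(1)])

text \<open>A change of generators has to replace \<open>z\<close> by \<open>f z\<close> on the left
  and by \<open>rev (f z)\<close> on the reversed right side. One homomorphism can do both only if
  the two sides use different letters, hence the disjoint copies \<open>pr z\<close> on the
  right.\<close>

lemma afl_word_problem_double:
  assumes wp: "word_problem G B q h \<in> C" and h: "h \<notin> B"
    and Z: "finite Z" and f: "f \<in> Z \<rightarrow> lists B"
    and pr: "inj_on pr Z" "pr ` Z \<inter> Z = {}" and k: "k \<notin> Z" "k \<notin> pr ` Z"
  shows "{u @ [k] @ map pr (rev v) | u v. u \<in> lists Z \<and> v \<in> lists Z \<and>
           word_eval G q (word_hom f u) = word_eval G q (word_hom f v)} \<in> C" (is "?S \<in> C")
proof -
  define g where "g x = (if x = k then [h] else if x \<in> Z then f x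
    else rev (f (inv_into Z pr x)))" for x
  have gl: "word_hom g u = word_hom f u" if "u \<in> lists Z" for u
    using that by induction (use k in \<open>auto simp: g_def\<close>)
  have gr: "word_hom g (map pr (rev v)) = rev (word_hom f v)" if "v \<in> lists Z" for v
    using that
  proof induction
    case (Cons a v)
    have "pr a \<noteq> k" "pr a \<notin> Z" using Cons k pr by auto
    then have "g (pr a) = rev (f a)" using Cons pr by (simp add: g_def)
    then show ?case using Cons by simp
  qed simp
  have mem: "word_hom f u @ [h] @ rev (word_hom f v) \<in> word_problem G B q h \<longleftrightarrow>
      word_eval G q (word_hom f u) = word_eval G q (word_hom f v)"
    if "u \<in> lists Z" "v \<in> lists Z" for u v
    using that word_hom_in_lists[OF f] by (intro word_problem_iff[OF h]) auto
  have "{u @ [k] @ v | u v. u \<in> lists Z \<and> v \<in> lists (pr ` Z) \<and>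
           word_hom g u @ g k @ word_hom g v \<in> word_problem G B q h} \<in> C" (is "?T \<in> C")
    using Z k by (intro afl_separated[OF wp]) auto
  also have "?T = ?S"
  proof (intro equalityI subsetI)
    fix w assume "w \<in> ?T"
    then obtain u v where w: "w = u @ [k] @ v" "u \<in> lists Z" "v \<in> lists (pr ` Z)"
      "word_hom g u @ g k @ word_hom g v \<in> word_problem G B q h" by blast
    then obtain v' where v': "v = map pr v'" "v' \<in> lists Z"
      by (auto simp: lists_image)
    then have "v = map pr (rev (rev v'))" "rev v' \<in> lists Z" by auto
    moreover from this have "word_eval G q (word_hom f u) = word_eval G q (word_hom f (rev v'))"
      using w gl[OF w(2)] gr[of "rev v'"] mem[of u "rev v'"] by (simp add: g_def)
    ultimately show "w \<in> ?S" using w by blast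
  next
    fix w assume "w \<in> ?S"
    then obtain u v where w: "w = u @ [k] @ map pr (rev v)" "u \<in> lists Z" "v \<in> lists Z"
      "word_eval G q (word_hom f u) = word_eval G q (word_hom f v)" by blast
    then have "word_hom g u @ g k @ word_hom g (map pr (rev v)) \<in> word_problem G B q h"
      using mem gl gr by (simp add: g_def)
    moreover have "map pr (rev v) \<in> lists (pr ` Z)" using w(3) by auto
    ultimately show "w \<in> ?T" using w by blast
  qed
  finally show ?thesis .
qed

lemma afl_word_problem_fibre:
  assumes wp: "word_problem G B q h \<in> C" and h: "h \<notin> B"
    and Z: "finite Z" and f: "f \<in> Z \<rightarrow> lists B" and t: "t \<in> lists B"
  shows "{u \<in> lists Z. word_eval G q (word_hom f u) = word_eval G q t} \<in> C" (is "?S \<in> C")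
proof -
  obtain k where k: "k \<notin> Z"
    using ex_new_if_finite[OF infinite_UNIV_nat Z] by blast
  \<comment> \<open>The fresh letter \<open>k\<close> carries the separator together with the fixed
    right-hand word \<open>rev t\<close>. A final homomorphism erases it.\<close>
  define g where "g x = (if x = k then [h] @ rev t else f x)" for x
  have g: "word_hom g u = word_hom f u" if "u \<in> lists Z" for u
    using that by induction (use k in \<open>auto simp: g_def\<close>)
  have mem: "word_hom f u @ [h] @ rev t \<in> word_problem G B q h \<longleftrightarrow>
      word_eval G q (word_hom f u) = word_eval G q t"
    if "u \<in> lists Z" for u
    using that word_hom_in_lists[OF f] t by (intro word_problem_iff[OF h]) auto
  let ?T = "{u @ [k] @ v | u v. u \<in> lists Z \<and> v \<in> lists {} \<and>
           word_hom g u @ g k @ word_hom g v \<in> word_problem G B q h}"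
  have T: "?T = (\<lambda>u. u @ [k]) ` ?S"
  proof -
    have "word_hom g u @ g k @ word_hom g [] \<in> word_problem G B q h \<longleftrightarrow>
        word_eval G q (word_hom f u) = word_eval G q t" if "u \<in> lists Z" for u
      using mem[OF that] g[OF that] by (simp add: g_def)
    then show ?thesis by (auto simp del: in_lists_conv_set)
  qed
  have "?T \<in> C"
    using Z k by (intro afl_separated[OF wp]) auto
  then have "word_hom (\<lambda>x. if x = k then [] else [x]) ` ?T \<in> C"
    by (rule afl_hom)
  also have "word_hom (\<lambda>x. if x = k then [] else [x]) ` ?T = ?S"
  proof -
    have "word_hom (\<lambda>x. if x = k then [] else [x]) u = u" if "u \<in> lists Z" for u
      using that by induction (use k in auto)
    then have "word_hom (\<lambda>x. if x = k then [] else [x]) (u @ [k]) = u" if "u \<in> ?S" for u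
      using that by simp
    then show ?thesis
      unfolding T image_image by (subst image_cong[OF HOL.refl, of _ _ "\<lambda>u. u"]) blast+
  qed
  finally show ?thesis .
qed

end

section \<open>Iterated substitution as derivation in a grammar\<close>

inductive derives :: "('a \<Rightarrow> 'a list set) \<Rightarrow> 'a list \<Rightarrow> 'a list \<Rightarrow> bool" for \<sigma> where
  derives_refl: "derives \<sigma> w w"
| derives_step: "derives \<sigma> w (x @ [a] @ y) \<Longrightarrow> r \<in> \<sigma> a \<Longrightarrow> derives \<sigma> w (x @ r @ y)"

lemma derives_trans:
  assumes "derives \<sigma> v w" "derives \<sigma> u v"
  shows "derives \<sigma> u w"
  using assms by induction (auto intro: derives.intros)

lemma derives_letter: "r \<in> \<sigma> a \<Longrightarrow> derives \<sigma> [a] r"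
  using derives_step[of \<sigma> "[a]" "[]" a "[]"] derives_refl[of \<sigma> "[a]"] by simp

lemma derives_context:
  assumes "derives \<sigma> u v"
  shows "derives \<sigma> (x @ u @ y) (x @ v @ y)"
  using assms
proof induction
  case (derives_step w x' a y' r)
  then show ?case using derives.derives_step[of \<sigma> "x @ w @ y" "x @ x'" a "y' @ y" r] by simp
qed (rule derives_refl)

lemma derives_append:
  assumes "derives \<sigma> u u'" "derives \<sigma> v v'"
  shows "derives \<sigma> (u @ v) (u' @ v')"
proof (rule derives_trans)
  show "derives \<sigma> (u @ v) (u' @ v)"
    using derives_context[OF assms(1), of "[]" v] by simp
  show "derives \<sigma> (u' @ v) (u' @ v')"
    using derives_context[OF assms(2), of u' "[]"] by simp
qed

lemma derives_subst_word:
  "v \<in> subst_word \<sigma> w \<Longrightarrow> derives \<sigma> w v"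
proof (induction w arbitrary: v)
  case (Cons a w)
  then obtain r v' where "v = r @ v'" "r \<in> \<sigma> a" "v' \<in> subst_word \<sigma> w"
    by (auto simp: conc_def)
  then show ?case using derives_append[OF derives_letter, of r \<sigma> a w v'] Cons.IH by simp
qed (auto intro: derives_refl)

lemma subst_word_append: "subst_word \<sigma> (u @ v) = conc (subst_word \<sigma> u) (subst_word \<sigma> v)"
proof (induction u)
  case (Cons a u)
  then show ?case by (auto simp: conc_def) (metis append.assoc)+
qed (auto simp: conc_def)

lemma subst_word_refl:
  assumes "\<And>a. [a] \<in> \<sigma> a"
  shows "w \<in> subst_word \<sigma> w"
proof (induction w)
  case (Cons a w)
  then have "[a] @ w \<in> conc (\<sigma> a) (subst_word \<sigma> w)"
    unfolding conc_def using assms by blast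
  then show ?case by simp
qed simp

text \<open>A substitution replaces all letters at once, a derivation step only one. As every letter
  may be kept, one round of substitution imitates a single step, and conversely it is a sequence of
  such steps.\<close>

lemma iterated_subst_eq_derives:
  assumes "\<And>a. [a] \<in> ext_subst \<Gamma> s a"
  shows "iterated_subst \<Gamma> s L = {w. \<exists>u\<in>L. derives (ext_subst \<Gamma> s) u w}"
proof (intro equalityI subsetI)
  fix w assume "w \<in> iterated_subst \<Gamma> s L"
  then obtain n where "w \<in> (subst_lang (ext_subst \<Gamma> s) ^^ n) L"
    by (auto simp: iterated_subst_def)
  then have "\<exists>u\<in>L. derives (ext_subst \<Gamma> s) u w"
  proof (induction n arbitrary: w)
    case (Suc n)
    then obtain v where "v \<in> (subst_lang (ext_subst \<Gamma> s) ^^ n) L" "w \<in> subst_word (ext_subst \<Gamma> s) v"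
      by (auto simp: subst_lang_def[of _ "(subst_lang _ ^^ n) L"])
    then show ?case using Suc.IH derives_trans[OF derives_subst_word] by blast
  qed (auto intro: derives_refl)
  then show "w \<in> {w. \<exists>u\<in>L. derives (ext_subst \<Gamma> s) u w}" by simp
next
  fix w assume "w \<in> {w. \<exists>u\<in>L. derives (ext_subst \<Gamma> s) u w}"
  then obtain u where "derives (ext_subst \<Gamma> s) u w" "u \<in> L" by blast
  then have "\<exists>n. w \<in> (subst_lang (ext_subst \<Gamma> s) ^^ n) L"
  proof induction
    case (derives_refl w)
    then show ?case by (intro exI[of _ 0]) simp
  next
    case (derives_step w x a y r)
    then obtain n where n: "x @ [a] @ y \<in> (subst_lang (ext_subst \<Gamma> s) ^^ n) L" by blast
    have "x @ r @ y \<in> subst_word (ext_subst \<Gamma> s) (x @ [a] @ y)"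
      using subst_word_refl[of "ext_subst \<Gamma> s", OF assms] derives_step(2)
      unfolding subst_word_append by (simp add: conc_def) blast
    with n show ?case by (intro exI[of _ "Suc n"]) (auto simp: subst_lang_def[of _ "(subst_lang _ ^^ n) L"])
  qed
  then show "w \<in> iterated_subst \<Gamma> s L" by (auto simp: iterated_subst_def)
qed

section \<open>Rewriting\<close>

definition joinable :: "('a \<Rightarrow> 'a \<Rightarrow> bool) \<Rightarrow> 'a \<Rightarrow> 'a \<Rightarrow> bool" where
  "joinable r x y \<longleftrightarrow> (\<exists>z. r\<^sup>*\<^sup>* x z \<and> r\<^sup>*\<^sup>* y z)"

text \<open>Newman's lemma: a terminating, locally confluent relation is confluent. The two first
  steps are joined by \<open>local\<close>, and the induction hypothesis is used once below each of
  them.\<close>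

lemma newman:
  assumes wf: "wfP r\<inverse>\<inverse>"
    and local: "\<And>x y z. r x y \<Longrightarrow> r x z \<Longrightarrow> joinable r y z"
    and "r\<^sup>*\<^sup>* x y" "r\<^sup>*\<^sup>* x z"
  shows "joinable r y z"
  using wf assms(3,4)
proof (induction x arbitrary: y z rule: wfp_induct_rule)
  case (less x)
  show ?case
  proof (cases "x = y \<or> x = z")
    case True
    with less.prems show ?thesis unfolding joinable_def by blast
  next
    case False
    obtain y1 where y1: "r x y1" "r\<^sup>*\<^sup>* y1 y"
      using less.prems(1) False by (cases rule: converse_rtranclpE) auto
    obtain z1 where z1: "r x z1" "r\<^sup>*\<^sup>* z1 z"
      using less.prems(2) False by (cases rule: converse_rtranclpE) auto
    obtain v where v: "r\<^sup>*\<^sup>* y1 v" "r\<^sup>*\<^sup>* z1 v"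
      using local[OF y1(1) z1(1)] unfolding joinable_def by blast
    obtain s where s: "r\<^sup>*\<^sup>* y s" "r\<^sup>*\<^sup>* v s"
      using less.IH[of y1, OF _ y1(2) v(1)] y1(1) unfolding joinable_def by blast
    have "r\<^sup>*\<^sup>* z1 s" using v(2) s(2) by (rule rtranclp_trans)
    then obtain t where "r\<^sup>*\<^sup>* s t" "r\<^sup>*\<^sup>* z t"
      using less.IH[of z1, OF _ _ z1(2)] z1(1) unfolding joinable_def by blast
    with s(1) show ?thesis unfolding joinable_def by (meson rtranclp_trans)
  qed
qed

lemma wfP_converse_decreasing:
  assumes "\<And>x y. r x y \<Longrightarrow> f y < (f x :: nat)"
  shows "wfP r\<inverse>\<inverse>"
  by (rule wfp_subset[OF wfp_if_convertible_to_nat[of "\<lambda>x y. f x < f y" f]]) (use assms in auto)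

lemma ex_normal_form:
  assumes "wfP r\<inverse>\<inverse>"
  shows "\<exists>y. r\<^sup>*\<^sup>* x y \<and> (\<nexists>z. r y z)"
  using assms
proof (induction x rule: wfp_induct_rule)
  case (less x)
  then show ?case by (metis conversep_iff converse_rtranclp_into_rtranclp rtranclp.rtrancl_refl)
qed

section \<open>Evaluation of words\<close>

context monoid
begin

lemma word_eval_closed:
  "p \<in> X \<rightarrow> carrier G \<Longrightarrow> w \<in> lists X \<Longrightarrow> word_eval G p w \<in> carrier G"
  by (induction w) (auto simp: word_eval_def)

lemma word_eval_append:
  assumes "p \<in> X \<rightarrow> carrier G" "u \<in> lists X" "v \<in> lists X"
  shows "word_eval G p (u @ v) = word_eval G p u \<otimes> word_eval G p v"
  using assms(2)
proof (induction u)
  case Nil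
  then show ?case using word_eval_closed[OF assms(1,3)] by (simp add: word_eval_def)
next
  case (Cons a u)
  then have "p a \<in> carrier G" using assms(1) by auto
  then show ?case
    using Cons.IH word_eval_closed[OF assms(1,3)] word_eval_closed[OF assms(1), of u] Cons.hyps
    by (simp add: word_eval_def m_assoc)
qed

lemma word_eval_simps [simp]:
  "word_eval G p [] = \<one>"
  "word_eval G p (a # w) = p a \<otimes> word_eval G p w"
  by (simp_all add: word_eval_def)

lemma word_eval_cong:
  "(\<And>a. a \<in> set w \<Longrightarrow> p a = q a) \<Longrightarrow> word_eval G p w = word_eval G q w"
  by (induction w) auto

lemma word_eval_hom:
  assumes "p \<in> B \<rightarrow> carrier G" "f \<in> Z \<rightarrow> lists B"
    and "\<And>x. x \<in> Z \<Longrightarrow> word_eval G p (f x) = q x" and "u \<in> lists Z"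
  shows "word_eval G p (word_hom f u) = word_eval G q u"
  using assms(4)
proof induction
  case (Cons a u)
  then show ?case
    using assms(2,3) by (simp add: word_eval_append[OF assms(1)] word_hom_in_lists[OF assms(2)] Pi_def)
qed simp

lemma UnitsI:
  assumes "y \<in> carrier G" "x \<in> carrier G" "z \<in> carrier G" "x \<otimes> y = \<one>" "y \<otimes> z = \<one>"
  shows "y \<in> Units G"
proof -
  have "x = x \<otimes> (y \<otimes> z)" using assms by simp
  also have "\<dots> = z" using assms m_assoc[of x y z] by simp
  finally show ?thesis using assms unfolding Units_def by blast
qed

text \<open>The overlap \<open>y\<close> has the left inverse
  \<open>inv (x \<otimes> y) \<otimes> x\<close> and the right inverse
  \<open>z \<otimes> inv (y \<otimes> z)\<close>; then \<open>x\<close> and \<open>z\<close> are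
  quotients of units. This resolves overlapping redexes and also splits irreducible unit
  words.\<close>

lemma Units_overlap:
  assumes "x \<in> carrier G" "y \<in> carrier G" "z \<in> carrier G"
    and xy: "x \<otimes> y \<in> Units G" and yz: "y \<otimes> z \<in> Units G"
  shows "x \<in> Units G" "y \<in> Units G" "z \<in> Units G"
proof -
  show y: "y \<in> Units G"
  proof (rule UnitsI)
    show "(inv (x \<otimes> y) \<otimes> x) \<otimes> y = \<one>"
      using assms by (simp add: m_assoc)
    show "y \<otimes> (z \<otimes> inv (y \<otimes> z)) = \<one>"
      using assms by (simp flip: m_assoc)
  qed (use assms in auto)
  have "x = (x \<otimes> y) \<otimes> inv y" "z = inv y \<otimes> (y \<otimes> z)"
    using assms y by (simp_all add: m_assoc) (simp flip: m_assoc)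
  then show "x \<in> Units G" "z \<in> Units G"
    using y xy yz by (metis Units_inv_Units Units_m_closed)+
qed

end

lemma append_eq_append_splitE:
  assumes "x @ y = u @ v" "length x \<le> length u"
  obtains g where "u = x @ g" "y = g @ v"
  using assms that[of "drop (length x) u"]
  by (metis append_eq_append_conv_if append_take_drop_id)

section \<open>A complete rewriting system for special monoids\<close>

text \<open>An isomorphism with the presented monoid, expressed through evaluation of words:
  \<open>relator\<close> makes congruent words equal in \<open>M\<close>, \<open>eval_eqD\<close> is
  the converse, and \<open>generates\<close> is surjectivity.\<close>

locale special_presentation = monoid M for M :: "('m, 'b) monoid_scheme" (structure) +
  fixes A :: "nat set" and W :: "nat list set" and p :: "nat \<Rightarrow> 'm"
  assumes finite_A: "finite A" and finite_W: "finite W" and W: "W \<subseteq> lists A"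
    and p: "p \<in> A \<rightarrow> carrier M"
    and generates: "word_eval M p ` lists A = carrier M"
    and eval_eqD: "u \<in> lists A \<Longrightarrow> v \<in> lists A \<Longrightarrow> word_eval M p u = word_eval M p v
      \<Longrightarrow> (u, v) \<in> pres_cong A (W \<times> {[]})"
    and relator: "w \<in> W \<Longrightarrow> word_eval M p w = \<one>"
begin

definition bound :: nat where
  "bound = Max (insert 0 (length ` W))"

definition unit_words :: "(nat + 'm) list set" where
  "unit_words = lists (A <+> Units M)"

definition ev :: "(nat + 'm) list \<Rightarrow> 'm" where
  "ev = word_eval M (case_sum p id)"

text \<open>The word \<open>s\<close> arises from \<open>t\<close> over \<open>A\<close> by
  contracting disjoint unit factors to letters. Contracted factors are nonempty, so that
  \<open>s\<close> is never longer than \<open>t\<close>.\<close>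

inductive contracts :: "(nat + 'm) list \<Rightarrow> nat list \<Rightarrow> bool" where
  contracts_Nil: "contracts [] []"
| contracts_letter: "a \<in> A \<Longrightarrow> contracts s t \<Longrightarrow> contracts (Inl a # s) (a # t)"
| contracts_unit: "v \<in> lists A \<Longrightarrow> v \<noteq> [] \<Longrightarrow> word_eval M p v \<in> Units M \<Longrightarrow> contracts s t \<Longrightarrow>
    contracts (Inr (word_eval M p v) # s) (v @ t)"

definition canon :: "(nat + 'm) list \<Rightarrow> (nat + 'm) list" where
  "canon s = (if ev s = \<one> then [] else [Inr (ev s)])"

text \<open>The length bound on the contracted word \<open>t\<close> (rather than on \<open>s\<close>) makes the set closed under
  replacing a unit factor by its canonical form.\<close>

definition redexes :: "(nat + 'm) list set" where
  "redexes = {s \<in> unit_words. ev s \<in> Units M \<and>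
     (s \<in> lists (range Inr) \<or> (\<exists>t. length t \<le> bound \<and> contracts s t))}"

text \<open>The condition \<open>l \<noteq> canon l\<close> excludes rewriting a unit letter or the
  empty word to itself, which would destroy termination.\<close>

definition step :: "(nat + 'm) list \<Rightarrow> (nat + 'm) list \<Rightarrow> bool" where
  "step x y \<longleftrightarrow> (\<exists>u l v. x = u @ l @ v \<and> y = u @ canon l @ v \<and> l \<in> redexes \<and> l \<noteq> canon l)"

lemma unit_words_simps [simp]:
  "[] \<in> unit_words"
  "Inl a # s \<in> unit_words \<longleftrightarrow> a \<in> A \<and> s \<in> unit_words"
  "Inr g # s \<in> unit_words \<longleftrightarrow> g \<in> Units M \<and> s \<in> unit_words"
  "s @ s' \<in> unit_words \<longleftrightarrow> s \<in> unit_words \<and> s' \<in> unit_words"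
  by (auto simp: unit_words_def)

lemma ev_letters: "case_sum p id \<in> (A <+> Units M) \<rightarrow> carrier M"
  using p by auto

lemma ev_simps [simp]:
  "ev [] = \<one>"
  "ev (Inl a # s) = p a \<otimes> ev s"
  "ev (Inr g # s) = g \<otimes> ev s"
  by (simp_all add: ev_def)

lemma ev_closed [simp]: "s \<in> unit_words \<Longrightarrow> ev s \<in> carrier M"
  unfolding ev_def unit_words_def by (rule word_eval_closed[OF ev_letters])

lemma ev_append:
  "s \<in> unit_words \<Longrightarrow> s' \<in> unit_words \<Longrightarrow> ev (s @ s') = ev s \<otimes> ev s'"
  unfolding ev_def unit_words_def by (rule word_eval_append[OF ev_letters])

lemma ev_map_Inl [simp]: "ev (map Inl u) = word_eval M p u"
  by (induction u) auto

lemma map_Inl_unit_words [simp]: "map Inl u \<in> unit_words \<longleftrightarrow> u \<in> lists A"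
  by (induction u) auto

lemma contractsD:
  assumes "contracts s t"
  shows "s \<in> unit_words" "t \<in> lists A" "ev s = word_eval M p t" "length s \<le> length t"
proof -
  have "s \<in> unit_words \<and> t \<in> lists A \<and> ev s = word_eval M p t \<and> length s \<le> length t"
    using assms
  proof induction
    case (contracts_unit v s t)
    then have "length v \<ge> 1" by (cases v) auto
    with contracts_unit show ?case by (auto simp: word_eval_append[OF p])
  qed auto
  then show "s \<in> unit_words" "t \<in> lists A" "ev s = word_eval M p t" "length s \<le> length t"
    by auto
qed

lemma contracts_append:
  "contracts s t \<Longrightarrow> contracts s' t' \<Longrightarrow> contracts (s @ s') (t @ t')"
  by (induction rule: contracts.induct) (auto intro: contracts.intros)

lemma contracts_split:
  "contracts (s @ s') t \<Longrightarrow> \<exists>u u'. t = u @ u' \<and> contracts s u \<and> contracts s' u'"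
proof (induction s arbitrary: t)
  case (Cons x s)
  from Cons.prems show ?case
  proof (cases rule: contracts.cases)
    case (contracts_letter a s0 t0)
    with Cons.IH[of t0] obtain u u' where "t0 = u @ u'" "contracts s u" "contracts s' u'" by auto
    with contracts_letter show ?thesis
      by (intro exI[of _ "a # u"] exI[of _ u']) (auto intro: contracts.intros)
  next
    case (contracts_unit v s0 t0)
    with Cons.IH[of t0] obtain u u' where "t0 = u @ u'" "contracts s u" "contracts s' u'" by auto
    with contracts_unit show ?thesis
      by (intro exI[of _ "v @ u"] exI[of _ u']) (auto intro: contracts.intros)
  qed simp
qed (auto intro: contracts.intros)

lemma contracts_map_Inl: "t \<in> lists A \<Longrightarrow> contracts (map Inl t) t"
  by (induction t) (auto intro: contracts.intros)

lemma redexesD: "s \<in> redexes \<Longrightarrow> s \<in> unit_words" "s \<in> redexes \<Longrightarrow> ev s \<in> Units M"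
  by (auto simp: redexes_def)

lemma unit_letters_in_redexes: "s \<in> lists (Inr ` Units M) \<Longrightarrow> s \<in> redexes"
proof -
  assume s: "s \<in> lists (Inr ` Units M)"
  then have "s \<in> unit_words \<and> ev s \<in> Units M" by induction auto
  with s show ?thesis by (auto simp: redexes_def)
qed

lemma ev_canon [simp]: "ev s \<in> carrier M \<Longrightarrow> ev (canon s) = ev s"
  by (simp add: canon_def)

lemma canon_in_unit_letters: "ev s \<in> Units M \<Longrightarrow> canon s \<in> lists (Inr ` Units M)"
  by (simp add: canon_def)

lemma canon_in_unit_words: "ev s \<in> Units M \<Longrightarrow> canon s \<in> unit_words"
  by (simp add: canon_def)

lemma canon_cong: "ev s = ev s' \<Longrightarrow> canon s = canon s'"
  by (simp add: canon_def)

lemma redexes_factor: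
  assumes "s @ e @ s' \<in> redexes" "ev e \<in> Units M"
  shows "e \<in> redexes"
proof (cases "s @ e @ s' \<in> lists (range Inr)")
  case True
  then show ?thesis using assms by (auto simp: redexes_def)
next
  case False
  with assms obtain t where t: "length t \<le> bound" "contracts (s @ e @ s') t"
    unfolding redexes_def by blast
  from contracts_split[OF t(2)] obtain u u' where u: "t = u @ u'" "contracts (e @ s') u'" by blast
  from contracts_split[OF u(2)] obtain v v' where "u' = v @ v'" "contracts e v" by blast
  then show ?thesis
    using assms t(1) u contractsD[of e v] by (auto simp: redexes_def)
qed

text \<open>The part of \<open>t\<close> that contracts to \<open>e\<close> has the same unit value
  as \<open>e\<close>. It can be contracted as a whole to one letter, or dropped if this value is
  \<open>\<one>\<close>, and the bound on \<open>t\<close> survives.\<close>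

lemma redexes_canon:
  assumes "s @ e @ s' \<in> redexes" "ev e \<in> Units M"
  shows "s @ canon e @ s' \<in> redexes"
proof -
  have words: "s \<in> unit_words" "e \<in> unit_words" "s' \<in> unit_words"
    using redexesD(1)[OF assms(1)] by auto
  have ev: "ev (s @ canon e @ s') = ev (s @ e @ s')"
    using words assms(2) canon_in_unit_words[OF assms(2)] by (simp add: ev_append)
  have unit: "ev (s @ canon e @ s') \<in> Units M" and word: "s @ canon e @ s' \<in> unit_words"
    using redexesD(2)[OF assms(1)] words canon_in_unit_words[OF assms(2)] by (simp_all add: ev)
  show ?thesis
  proof (cases "s @ e @ s' \<in> lists (range Inr)")
    case True
    then have "s @ canon e @ s' \<in> lists (range Inr)" by (auto simp: canon_def)
    with unit word show ?thesis by (simp add: redexes_def)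
  next
    case False
    with assms obtain t where t: "length t \<le> bound" "contracts (s @ e @ s') t"
      unfolding redexes_def by blast
    from contracts_split[OF t(2)] obtain u u' where u: "t = u @ u'" "contracts s u"
      "contracts (e @ s') u'" by blast
    from contracts_split[OF u(3)] obtain v v' where v: "u' = v @ v'" "contracts e v"
      "contracts s' v'" by blast
    have "\<exists>v0. length v0 \<le> length v \<and> contracts (canon e) v0"
    proof (cases "ev e = \<one>")
      case True
      then show ?thesis
        by (intro exI[of _ "[]"]) (simp add: canon_def contracts_Nil)
    next
      case False
      then have "v \<noteq> []" using contractsD(3,4)[OF v(2)] by auto
      then have "contracts [Inr (word_eval M p v)] (v @ [])"
        using contractsD[OF v(2)] assms(2) by (intro contracts.intros) simp_all
      with False show ?thesis
        using contractsD(3)[OF v(2)] by (intro exI[of _ v]) (simp add: canon_def)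
    qed
    then obtain v0 where v0: "length v0 \<le> length v" "contracts (canon e) v0" by blast
    have "contracts (s @ canon e @ s') (u @ v0 @ v')"
      using u(2) v0(2) v(3) by (intro contracts_append)
    moreover have "length (u @ v0 @ v') \<le> bound"
      using t(1) u(1) v(1) v0(1) by simp
    ultimately show ?thesis using unit word unfolding redexes_def by blast
  qed
qed

lemma map_Inl_redexes:
  "t \<in> lists A \<Longrightarrow> length t \<le> bound \<Longrightarrow> word_eval M p t \<in> Units M \<Longrightarrow> map Inl t \<in> redexes"
  using contracts_map_Inl by (auto simp: redexes_def)

lemma length_relator: "w \<in> W \<Longrightarrow> length w \<le> bound"
  unfolding bound_def using finite_W by simp

section \<open>Soundness, termination and confluence of reduction\<close>

lemma step_canon: "l \<in> redexes \<Longrightarrow> step\<^sup>*\<^sup>* l (canon l)"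
proof (cases "l = canon l")
  case False
  assume "l \<in> redexes"
  with False have "step ([] @ l @ []) ([] @ canon l @ [])" unfolding step_def by blast
  then show ?thesis by auto
qed simp

lemma step_context:
  assumes "step x y"
  shows "step (u @ x @ v) (u @ y @ v)"
proof -
  obtain u' l v' where *: "x = u' @ l @ v'" "y = u' @ canon l @ v'" "l \<in> redexes" "l \<noteq> canon l"
    using assms unfolding step_def by blast
  then have "u @ x @ v = (u @ u') @ l @ (v' @ v)" "u @ y @ v = (u @ u') @ canon l @ (v' @ v)"
    by simp_all
  with * show ?thesis unfolding step_def by blast
qed

lemma steps_context:
  "step\<^sup>*\<^sup>* x y \<Longrightarrow> step\<^sup>*\<^sup>* (u @ x @ v) (u @ y @ v)"
  by (induction rule: rtranclp_induct) (auto intro: step_context rtranclp.rtrancl_into_rtrancl)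

lemma steps_append:
  assumes "step\<^sup>*\<^sup>* x x'" "step\<^sup>*\<^sup>* y y'"
  shows "step\<^sup>*\<^sup>* (x @ y) (x' @ y')"
  using steps_context[OF assms(1), of "[]" y] steps_context[OF assms(2), of x' "[]"] by simp

lemma step_sound:
  assumes "step x y" "x \<in> unit_words"
  shows "y \<in> unit_words" "ev y = ev x"
proof -
  obtain u l v where *: "x = u @ l @ v" "y = u @ canon l @ v" "l \<in> redexes"
    using assms(1) unfolding step_def by blast
  note l = redexesD[OF *(3)] canon_in_unit_words[OF redexesD(2)[OF *(3)]]
  show "y \<in> unit_words" "ev y = ev x"
    using * assms(2) l by (simp_all add: ev_append)
qed

lemma steps_sound:
  assumes "step\<^sup>*\<^sup>* x y" "x \<in> unit_words"
  shows "y \<in> unit_words \<and> ev y = ev x"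
  using assms by (induction rule: rtranclp_induct) (auto dest: step_sound)

lemma wfP_step: "wfP step\<inverse>\<inverse>"
proof (rule wfP_converse_decreasing)
  \<comment> \<open>Letters of \<open>A\<close> weigh 2 and unit letters 1. A redex of length at
    least 2 outweighs its canonical form, which weighs at most 1. A non-canonical redex of length 1
    is either a letter of \<open>A\<close> or the letter of \<open>\<one>\<close>, which is
    deleted.\<close>
  define wt :: "(nat + 'm) list \<Rightarrow> nat"
    where "wt s = sum_list (map (case_sum (\<lambda>_. 2) (\<lambda>_. 1)) s)" for s
  fix x y :: "(nat + 'm) list"
  assume "step x y"
  then obtain u l v where *: "x = u @ l @ v" "y = u @ canon l @ v" "l \<in> redexes" "l \<noteq> canon l"
    unfolding step_def by blast
  have "l \<noteq> []" using *(4) by (auto simp: canon_def)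
  have wt: "wt (canon l) \<le> 1" "length l \<le> wt l"
    by (simp add: wt_def canon_def) (induction l, auto simp: wt_def split: sum.splits)
  have "wt (canon l) < wt l"
  proof (cases "length l \<le> 1")
    case True
    with \<open>l \<noteq> []\<close> obtain a where "l = [a]" by (cases l) auto
    then show ?thesis
      using *(4) redexesD(1)[OF *(3)] by (cases a) (auto simp: wt_def canon_def split: if_splits)
  qed (use wt in simp)
  then show "wt y < wt x" using * by (simp add: wt_def)
qed

text \<open>By \<open>Units_overlap\<close> the outer parts \<open>d\<close> and \<open>f\<close>
  are units, hence redexes themselves. Reducing them leaves words of unit letters only, and both
  collapse to \<open>canon (d @ e @ f)\<close>.\<close>

lemma joinable_canon_overlap:
  assumes "d @ e \<in> redexes" "e @ f \<in> redexes"
  shows "joinable step (canon (d @ e) @ f) (d @ canon (e @ f))"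
proof -
  have w: "d \<in> unit_words" "e \<in> unit_words" "f \<in> unit_words"
    using redexesD(1)[OF assms(1)] redexesD(1)[OF assms(2)] by auto
  then have "ev d \<otimes> ev e \<in> Units M" "ev e \<otimes> ev f \<in> Units M"
    using redexesD(2)[OF assms(1)] redexesD(2)[OF assms(2)] by (simp_all add: ev_append)
  note u = Units_overlap[OF ev_closed[OF w(1)] ev_closed[OF w(2)] ev_closed[OF w(3)] this]
  have d: "d \<in> redexes" using redexes_factor[of "[]" d e] assms u by simp
  have f: "f \<in> redexes" using redexes_factor[of e f "[]"] assms u by simp
  have de: "ev (d @ e) \<in> Units M" and ef: "ev (e @ f) \<in> Units M"
    using assms redexesD(2) by auto
  let ?c = "canon (d @ e @ f)"
  have "step\<^sup>*\<^sup>* (canon (d @ e) @ f) (canon (d @ e) @ canon f)"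
    by (intro steps_append step_canon f rtranclp.rtrancl_refl)
  also have "step\<^sup>*\<^sup>* \<dots> (canon (canon (d @ e) @ canon f))"
    by (intro step_canon unit_letters_in_redexes)
      (use canon_in_unit_letters[OF de] canon_in_unit_letters[OF u(3)] in simp)
  also have "canon (canon (d @ e) @ canon f) = ?c"
    using w u de ef by (intro canon_cong) (simp add: ev_append canon_in_unit_words m_assoc)
  finally have 1: "step\<^sup>*\<^sup>* (canon (d @ e) @ f) ?c" .
  have "step\<^sup>*\<^sup>* (d @ canon (e @ f)) (canon d @ canon (e @ f))"
    by (intro steps_append step_canon d rtranclp.rtrancl_refl)
  also have "step\<^sup>*\<^sup>* \<dots> (canon (canon d @ canon (e @ f)))"
    by (intro step_canon unit_letters_in_redexes)
      (use canon_in_unit_letters[OF ef] canon_in_unit_letters[OF u(1)] in simp)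
  also have "canon (canon d @ canon (e @ f)) = ?c"
    using w u de ef by (intro canon_cong) (simp add: ev_append canon_in_unit_words m_assoc)
  finally have 2: "step\<^sup>*\<^sup>* (d @ canon (e @ f)) ?c" .
  from 1 2 show ?thesis unfolding joinable_def by blast
qed

text \<open>After the inner redex is contracted the outer one is still a redex of the same value, by
  \<open>redexes_canon\<close>.\<close>

lemma joinable_canon_factor:
  assumes "d @ e @ f \<in> redexes" "e \<in> redexes"
  shows "joinable step (canon (d @ e @ f)) (d @ canon e @ f)"
proof -
  have w: "d \<in> unit_words" "e \<in> unit_words" "f \<in> unit_words" "ev e \<in> Units M"
    using redexesD(1)[OF assms(1)] redexesD(2)[OF assms(2)] by auto
  have "step\<^sup>*\<^sup>* (d @ canon e @ f) (canon (d @ canon e @ f))"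
    by (intro step_canon redexes_canon assms w)
  also have "canon (d @ canon e @ f) = canon (d @ e @ f)"
    using w by (intro canon_cong) (simp add: ev_append canon_in_unit_words)
  finally show ?thesis unfolding joinable_def by blast
qed

lemma joinable_context: "joinable step x y \<Longrightarrow> joinable step (u @ x @ v) (u @ y @ v)"
  unfolding joinable_def by (meson steps_context)

lemma joinable_sym: "joinable step x y \<Longrightarrow> joinable step y x"
  unfolding joinable_def by blast

text \<open>With \<open>l\<close> starting no later than \<open>l'\<close>, the redexes are disjoint
  and commute, or they overlap at their ends, or \<open>l'\<close> lies inside
  \<open>l\<close>.\<close>

lemma local_confluence_aux:
  assumes eq: "u @ l @ v = u' @ l' @ v'" and len: "length u \<le> length u'"
    and l: "l \<in> redexes" and l': "l' \<in> redexes"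
  shows "joinable step (u @ canon l @ v) (u' @ canon l' @ v')"
proof -
  obtain d where d: "u' = u @ d" and eq1: "l @ v = d @ l' @ v'"
    using append_eq_append_splitE[OF eq len] by blast
  have "joinable step (canon l @ v) (d @ canon l' @ v')"
  proof (cases "length l \<le> length d")
    case True
    then obtain g where g: "d = l @ g" and v: "v = g @ l' @ v'"
      using append_eq_append_splitE[OF eq1] by blast
    have "step\<^sup>*\<^sup>* (canon l @ g @ l' @ v') (canon l @ g @ canon l' @ v')"
      using steps_context[OF step_canon[OF l'], of "canon l @ g" v'] by simp
    moreover have "step\<^sup>*\<^sup>* (l @ g @ canon l' @ v') (canon l @ g @ canon l' @ v')"
      by (intro steps_append step_canon l rtranclp.rtrancl_refl)
    ultimately show ?thesis unfolding joinable_def g v by auto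
  next
    case False
    then obtain e where e: "l = d @ e" and eq2: "e @ v = l' @ v'"
      using append_eq_append_splitE[OF eq1[symmetric]] by (metis nat_le_linear)
    show ?thesis
    proof (cases "length e \<le> length l'")
      case True
      then obtain f where f: "l' = e @ f" "v = f @ v'"
        using append_eq_append_splitE[OF eq2] by blast
      show ?thesis
        using joinable_context[OF joinable_canon_overlap[of d e f], of "[]" v'] l l' e f by simp
    next
      case False
      then obtain f where f: "e = l' @ f" "v' = f @ v"
        using append_eq_append_splitE[OF eq2[symmetric]] by (metis nat_le_linear)
      show ?thesis
        using joinable_context[OF joinable_canon_factor[of d l' f], of "[]" v] l l' e f by simp
    qed
  qed
  from joinable_context[OF this, of u "[]"] show ?thesis by (simp add: d)
qed

lemma confluence:
  assumes "step\<^sup>*\<^sup>* x y" "step\<^sup>*\<^sup>* x z"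
  shows "joinable step y z"
proof (rule newman[OF wfP_step _ assms])
  fix x y z assume "step x y" "step x z"
  then obtain u l v u' l' v' where "x = u @ l @ v" "y = u @ canon l @ v" "l \<in> redexes"
    "x = u' @ l' @ v'" "z = u' @ canon l' @ v'" "l' \<in> redexes"
    unfolding step_def by blast
  then show "joinable step y z"
    using local_confluence_aux[of u l v u' l' v'] local_confluence_aux[of u' l' v' u l v]
    by (cases "length u \<le> length u'") (auto intro: joinable_sym)
qed

section \<open>Equality in the monoid and normal forms of units\<close>

lemma joinable_trans:
  assumes "joinable step x y" "joinable step y z"
  shows "joinable step x z"
proof -
  obtain s t where s: "step\<^sup>*\<^sup>* x s" "step\<^sup>*\<^sup>* y s" and t: "step\<^sup>*\<^sup>* y t" "step\<^sup>*\<^sup>* z t"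
    using assms unfolding joinable_def by blast
  obtain r where "step\<^sup>*\<^sup>* s r" "step\<^sup>*\<^sup>* t r"
    using confluence[OF s(2) t(1)] unfolding joinable_def by blast
  with s(1) t(2) show ?thesis unfolding joinable_def by (meson rtranclp_trans)
qed

lemma steps_joinable: "step\<^sup>*\<^sup>* x y \<Longrightarrow> joinable step x y"
  unfolding joinable_def by blast

text \<open>Joinability is a congruence, transitive because of confluence. It contains the relations
  because a relator is short enough to be a redex and has canonical form \<open>[]\<close>.\<close>

lemma joinable_if_pres_cong:
  "(u, v) \<in> pres_cong A (W \<times> {[]}) \<Longrightarrow> joinable step (map Inl u) (map Inl v)"
proof (induction rule: pres_cong.induct)
  case (rel u v)
  then have "map Inl u \<in> redexes"
    using relator length_relator by (intro map_Inl_redexes) auto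
  from step_canon[OF this] rel show ?case
    using relator by (intro steps_joinable) (auto simp: canon_def)
next
  case (mult u v u' v')
  then show ?case
    unfolding joinable_def map_append by (meson steps_append)
qed (auto intro: joinable_sym joinable_trans simp: joinable_def[of _ x x for x])

lemma joinable_if_eval_eq:
  "u \<in> lists A \<Longrightarrow> v \<in> lists A \<Longrightarrow> word_eval M p u = word_eval M p v \<Longrightarrow>
    joinable step (map Inl u) (map Inl v)"
  by (rule joinable_if_pres_cong[OF eval_eqD])

text \<open>The word \<open>x\<close> acts as a right inverse of \<open>w\<close>. A redex in
  \<open>w\<close> followed by the normal form of \<open>x\<close> must straddle the boundary, which
  splits \<open>w\<close> into units \<open>u\<close> and \<open>g\<close>. Here \<open>g\<close> is
  a unit letter by irreducibility and \<open>u\<close> is canonical by induction with right inverse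
  \<open>g @ x\<close>, so \<open>w\<close> consists of unit letters and is itself a redex.\<close>

lemma irreducible_unit_eq_canon:
  assumes "\<nexists>y. step w y" "w \<in> unit_words" "ev w \<in> Units M" "joinable step (w @ x) []"
  shows "w = canon w"
  using assms
proof (induction "length w" arbitrary: w x rule: less_induct)
  case less
  have no_step: "l = canon l" if "w = u @ l @ v" "l \<in> redexes" for u l v
    using less.prems(1) that unfolding step_def by blast
  have Nil_irr: "s = []" if "step\<^sup>*\<^sup>* [] s" for s
    using that by (cases rule: converse_rtranclpE) (auto simp: step_def canon_def)
  obtain x' where x': "step\<^sup>*\<^sup>* x x'" "\<nexists>y. step x' y"
    using ex_normal_form[OF wfP_step] by blast
  have "joinable step (w @ x') []"
    using less.prems(4) x'(1) steps_append[of w w x x']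
    by (metis joinable_sym joinable_trans rtranclp.rtrancl_refl steps_joinable)
  then have red: "step\<^sup>*\<^sup>* (w @ x') []"
    unfolding joinable_def using Nil_irr by blast
  show ?case
  proof (cases "w = []")
    case True
    then show ?thesis by (simp add: canon_def)
  next
    case False
    with red obtain y where "step (w @ x') y"
      by (cases rule: converse_rtranclpE) auto
    then obtain u l v where l: "w @ x' = u @ l @ v" "l \<in> redexes" "l \<noteq> canon l"
      unfolding step_def by blast
    \<comment> \<open>Both \<open>w\<close> and \<open>x'\<close> are irreducible, so
      \<open>l\<close> can lie inside neither of them.\<close>
    have "\<not> length w \<le> length u"
    proof
      assume "length w \<le> length u"
      then obtain g where "x' = g @ l @ v"
        using append_eq_append_splitE[OF l(1)] by blast
      with l x'(2) show False unfolding step_def by blast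
    qed
    then obtain g where g: "w = u @ g" "g @ x' = l @ v" "g \<noteq> []"
      using append_eq_append_splitE[OF l(1)[symmetric]]
      by (metis append_Nil2 nat_le_linear order_refl)
    have "\<not> length l \<le> length g"
    proof
      assume "length l \<le> length g"
      then obtain f where "g = l @ f"
        using append_eq_append_splitE[OF g(2)[symmetric]] by blast
      with g(1) no_step l show False by blast
    qed
    then obtain f where f: "l = g @ f" "x' = f @ v"
      using append_eq_append_splitE[OF g(2)] by (metis nat_le_linear)
    have words: "u \<in> unit_words" "g \<in> unit_words" "f \<in> unit_words"
      using less.prems(2) g(1) redexesD(1)[OF l(2)] f(1) by auto
    then have "ev u \<otimes> ev g \<in> Units M" "ev g \<otimes> ev f \<in> Units M"
      using less.prems(3) redexesD(2)[OF l(2)] unfolding g(1) f(1) by (simp_all add: ev_append)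
    note units = Units_overlap[OF ev_closed[OF words(1)] ev_closed[OF words(2)]
        ev_closed[OF words(3)] this]
    have "g \<in> redexes"
      using redexes_factor[of "[]" g f] l(2) f(1) units by simp
    then have "g = canon g" using no_step[of u g "[]"] g(1) by simp
    then obtain h where h: "g = [Inr h]" "h \<in> Units M"
      using g(3) units by (auto simp: canon_def split: if_splits)
    have "u = canon u"
    proof (rule less.hyps)
      show "length u < length w" using g by simp
      show "\<nexists>y. step u y"
        using less.prems(1) step_context[of u _ "[]" g] unfolding g(1) by auto
      show "joinable step (u @ g @ x) []" using less.prems(4) g(1) by simp
    qed (use words units in auto)
    then have "w \<in> lists (Inr ` Units M)"
      using h g(1) canon_in_unit_letters[OF units(1)] by simp
    from unit_letters_in_redexes[OF this] show ?thesis
      using no_step[of "[]" w "[]"] by simp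
  qed
qed

lemma unit_reduces_to_canon:
  assumes "v \<in> lists A" "word_eval M p v \<in> Units M"
  shows "step\<^sup>*\<^sup>* (map Inl v) (canon (map Inl v))"
proof -
  \<comment> \<open>A word for the inverse supplies the right inverse that
    \<open>irreducible_unit_eq_canon\<close> asks for.\<close>
  obtain x where x: "x \<in> lists A" "word_eval M p x = inv (word_eval M p v)"
    using generates assms(2) by (metis Units_inv_closed image_iff)
  then have eq: "word_eval M p (v @ x) = word_eval M p []"
    using assms by (simp add: word_eval_append[OF p])
  have 0: "joinable step (map Inl v @ map Inl x) []"
    using joinable_if_eval_eq[OF _ _ eq] assms(1) x(1) by simp
  obtain w where w: "step\<^sup>*\<^sup>* (map Inl v) w" "\<nexists>y. step w y"
    using ex_normal_form[OF wfP_step] by blast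
  have sound: "w \<in> unit_words \<and> ev w = word_eval M p v"
    using steps_sound[OF w(1)] assms(1) by simp
  have "step\<^sup>*\<^sup>* (map Inl v @ map Inl x) (w @ map Inl x)"
    by (intro steps_append w rtranclp.rtrancl_refl)
  then have "joinable step (w @ map Inl x) []"
    using 0 by (meson joinable_sym joinable_trans steps_joinable)
  with w(2) sound assms(2) have "w = canon w"
    by (intro irreducible_unit_eq_canon) auto
  also have "canon w = canon (map Inl v)"
    using sound by (intro canon_cong) simp
  finally show ?thesis using w(1) by simp
qed

end

section \<open>The grammar of a special monoid\<close>

lemma insert_eq_cases:
  assumes "x @ [a] @ y = s @ [b] @ m"
  obtains (centre) "x = s" "a = b" "y = m"
  | (left) g where "s = x @ [a] @ g" "y = g @ [b] @ m"
  | (right) g where "x = s @ [b] @ g" "m = g @ [a] @ y"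
proof (cases "length x \<le> length s")
  case True
  then obtain g where g: "s = x @ g" "[a] @ y = g @ [b] @ m"
    using append_eq_append_splitE[OF assms] by blast
  then show ?thesis using that by (cases g) auto
next
  case False
  then obtain g where g: "x = s @ g" "[b] @ m = g @ [a] @ y"
    using append_eq_append_splitE[OF assms[symmetric]] by (metis nat_le_linear)
  then show ?thesis using that by (cases g) auto
qed

section \<open>The nonterminals, their coding and the rules\<close>

context special_presentation
begin

definition small_units :: "'m set" where
  "small_units = word_eval M p ` {t \<in> lists A. length t \<le> bound} \<inter> Units M"

definition sep :: nat where
  "sep = Suc (Max (insert 0 A))"

text \<open>The letters coding the small units are \<open>sep + 1, sep + 3, \<dots>\<close>, and the letters
  \<open>sep + 2, sep + 4, \<dots>\<close> are their copies used to the right of the separator, where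
  everything is reversed.\<close>

definition code :: "'m \<Rightarrow> nat" where
  "code g = sep + 1 + 2 * to_nat_on small_units g"

definition Z :: "nat set" where
  "Z = code ` small_units"

text \<open>Decodes a letter of \<open>Z\<close> by undoing the arithmetic of \<open>code\<close>.
  The value at letters outside \<open>A\<close> and \<open>Z\<close> is arbitrary.\<close>

definition val :: "nat \<Rightarrow> 'm" where
  "val x = (if x \<in> A then p x else from_nat_into small_units ((x - sep - 1) div 2))"

text \<open>Letters of \<open>A\<close> are terminals and never rewritten, so they need no separate
  copy on the right. A nonterminal does, since its rules are reversed there.\<close>

definition bar :: "nat \<Rightarrow> nat" where
  "bar x = (if x \<in> Z then Suc x else x)"

definition mirror :: "nat list \<Rightarrow> nat list" where
  "mirror s = map bar (rev s)"

text \<open>The first set is a fibre of evaluation in the group of units. The second is finite, and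
  its bound \<open>2 * bound + 1\<close> is the largest possible length of \<open>pad s\<close> when
  \<open>s\<close> contracts a word of length at most \<open>bound\<close>.\<close>

definition unit_rules :: "nat \<Rightarrow> nat list set" where
  "unit_rules x = {u \<in> lists Z. word_eval M val u = val x} \<union>
     {s \<in> lists (A \<union> Z). length s \<le> 2 * bound + 1 \<and> word_eval M val s = val x}"

definition sep_rules :: "nat list set" where
  "sep_rules = {u @ [sep] @ mirror v | u v. u \<in> lists Z \<and> v \<in> lists Z \<and>
      word_eval M val u = word_eval M val v} \<union> (\<lambda>a. [a, sep, a]) ` A"

text \<open>The last branch serves the copies \<open>Suc z\<close> with \<open>z\<close> in
  \<open>Z\<close>, where \<open>x - 1\<close> recovers \<open>z\<close>. Outside
  \<open>nonterminals\<close> the value is ignored by \<open>ext_subst\<close>.\<close>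

definition rules :: "nat \<Rightarrow> nat list set" where
  "rules x = (if x = sep then sep_rules else if x \<in> Z then unit_rules x
     else mirror ` unit_rules (x - 1))"

abbreviation nonterminals :: "nat set" where
  "nonterminals \<equiv> insert sep (Z \<union> Suc ` Z)"

abbreviation derives\<^sub>M :: "nat list \<Rightarrow> nat list \<Rightarrow> bool" where
  "derives\<^sub>M \<equiv> derives (ext_subst nonterminals rules)"

lemma finite_small_units: "finite small_units"
  unfolding small_units_def by (intro finite_Int disjI1 finite_imageI finite_lists_length_le
      finite_subset[OF _ finite_lists_length_le[OF finite_A, of bound]]) auto

lemma finite_Z: "finite Z"
  unfolding Z_def using finite_small_units by simp

lemma small_units_subset: "g \<in> small_units \<Longrightarrow> g \<in> Units M"
  by (simp add: small_units_def)

lemma small_units_closed: "g \<in> small_units \<Longrightarrow> g \<in> carrier M"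
  by (intro Units_closed small_units_subset)

lemma code_in_Z: "g \<in> small_units \<Longrightarrow> code g \<in> Z"
  by (simp add: Z_def)

lemma one_small_unit: "\<one> \<in> small_units"
  unfolding small_units_def by (auto intro!: image_eqI[of _ _ "[]"])

lemma A_less_sep: "a \<in> A \<Longrightarrow> a < sep"
  unfolding sep_def using finite_A by (simp add: less_Suc_eq_le)

lemma Z_disjoint:
  "sep \<notin> A" "sep \<notin> Z" "sep \<notin> Suc ` Z" "Z \<inter> A = {}" "Suc ` Z \<inter> A = {}" "Suc ` Z \<inter> Z = {}"
proof -
  show "sep \<notin> A" "sep \<notin> Z" "sep \<notin> Suc ` Z" "Z \<inter> A = {}" "Suc ` Z \<inter> A = {}"
    using A_less_sep by (fastforce simp: Z_def code_def)+
  have "Suc (code g) \<noteq> code g'" for g g'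
    unfolding code_def by presburger
  then show "Suc ` Z \<inter> Z = {}" by (auto simp: Z_def)
qed

lemma val_code: "g \<in> small_units \<Longrightarrow> val (code g) = g"
  using A_less_sep[of "code g"] finite_small_units
  by (auto simp: val_def code_def countable_finite)

lemma val_A: "a \<in> A \<Longrightarrow> val a = p a"
  by (simp add: val_def)

lemma val_Z: "x \<in> Z \<Longrightarrow> val x \<in> Units M"
  using val_code small_units_subset by (auto simp: Z_def)

lemma val_closed: "val \<in> A \<union> Z \<rightarrow> carrier M"
  using val_A p val_Z by auto

lemma eval_val_A: "u \<in> lists A \<Longrightarrow> word_eval M val u = word_eval M p u"
  by (rule word_eval_cong) (auto simp: val_A)

lemma eval_val_append:
  "u \<in> lists (A \<union> Z) \<Longrightarrow> v \<in> lists (A \<union> Z) \<Longrightarrow>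
    word_eval M val (u @ v) = word_eval M val u \<otimes> word_eval M val v"
  by (rule word_eval_append[OF val_closed])

lemma eval_val_closed: "u \<in> lists (A \<union> Z) \<Longrightarrow> word_eval M val u \<in> carrier M"
  by (rule word_eval_closed[OF val_closed])

lemma eval_val_Z: "u \<in> lists Z \<Longrightarrow> word_eval M val u \<in> Units M"
  by (induction u) (auto simp: val_Z)

lemma lists_Z_le: "u \<in> lists Z \<Longrightarrow> u \<in> lists (A \<union> Z)"
  by auto

lemma bar_simps: "a \<in> A \<Longrightarrow> bar a = a" "x \<in> Z \<Longrightarrow> bar x = Suc x"
  using Z_disjoint by (auto simp: bar_def)

lemma bar_in_A: "bar x \<in> A \<Longrightarrow> x \<in> A"
  using Z_disjoint(5) by (auto simp: bar_def split: if_splits)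

lemma mirror_simps [simp]:
  "mirror [] = []"
  "mirror (u @ v) = mirror v @ mirror u"
  "mirror (x # u) = mirror u @ [bar x]"
  by (simp_all add: mirror_def)

lemma mirror_A: "u \<in> lists A \<Longrightarrow> mirror u = rev u"
  unfolding mirror_def by (intro map_idI) (auto simp: bar_simps)

lemma mirror_in_lists_A: "mirror u \<in> lists A \<Longrightarrow> u \<in> lists A"
  by (auto simp: mirror_def dest: bar_in_A)

lemma sep_notin_mirror: "u \<in> lists (A \<union> Z) \<Longrightarrow> sep \<notin> set (mirror u)"
  using Z_disjoint by (auto simp: mirror_def bar_def)

lemma mirror_split:
  assumes "mirror t = g @ [a] @ y"
  obtains g' b y' where "t = y' @ [b] @ g'" "g = mirror g'" "a = bar b" "y = mirror y'"
proof -
  have "map bar (rev t) = g @ ([a] @ y)" using assms by (simp add: mirror_def)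
  then obtain l1 l where l: "rev t = l1 @ l" "g = map bar l1" "[a] @ y = map bar l"
    by (metis map_eq_append_conv)
  then obtain b l3 where b: "l = b # l3" "a = bar b" "y = map bar l3" by auto
  have "t = rev (rev t)" by simp
  also have "\<dots> = rev l3 @ [b] @ rev l1" unfolding l(1) b by simp
  finally show ?thesis using l b that[of "rev l3" b "rev l1"] by (simp add: mirror_def)
qed

lemma ext_rules:
  "ext_subst nonterminals rules sep = sep_rules"
  "x \<in> Z \<Longrightarrow> ext_subst nonterminals rules x = unit_rules x"
  "x \<in> Z \<Longrightarrow> ext_subst nonterminals rules (Suc x) = mirror ` unit_rules x"
  "a \<in> A \<Longrightarrow> ext_subst nonterminals rules a = {[a]}"
proof -
  show "ext_subst nonterminals rules sep = sep_rules"
    by (simp add: ext_subst_def rules_def)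
  show "ext_subst nonterminals rules x = unit_rules x" if "x \<in> Z"
    using that Z_disjoint by (auto simp: ext_subst_def rules_def)
  show "ext_subst nonterminals rules (Suc x) = mirror ` unit_rules x" if "x \<in> Z"
  proof -
    have "Suc x \<noteq> sep" "Suc x \<notin> Z" using that Z_disjoint(6) by (auto simp: Z_def code_def)
    then show ?thesis using that by (simp add: ext_subst_def rules_def)
  qed
  show "ext_subst nonterminals rules a = {[a]}" if "a \<in> A"
    using that Z_disjoint by (auto simp: ext_subst_def)
qed

lemma ext_rules_bar:
  "x \<in> A \<union> Z \<Longrightarrow> ext_subst nonterminals rules (bar x) = mirror ` ext_subst nonterminals rules x"
  by (auto simp: ext_rules bar_simps)

lemma ext_rules_refl: "[x] \<in> ext_subst nonterminals rules x"
proof (cases "x \<in> nonterminals")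
  case True
  have Z: "[z] \<in> unit_rules z" if "z \<in> Z" for z
    using that val_Z by (simp add: unit_rules_def Units_closed)
  consider "x = sep" | "x \<in> Z" | z where "z \<in> Z" "x = Suc z" using True by blast
  then show ?thesis
  proof cases
    case 1
    have "[] @ [sep] @ mirror [] \<in> sep_rules" unfolding sep_rules_def by blast
    then show ?thesis using 1 by (simp add: ext_rules)
  next
    case 2
    then show ?thesis using Z by (simp add: ext_rules)
  next
    case 3
    then show ?thesis
      using Z[of z] by (auto simp: ext_rules bar_simps intro!: image_eqI[of _ _ "[z]"])
  qed
qed (simp add: ext_subst_def)

section \<open>Soundness of the grammar\<close>

lemma ext_rules_sound:
  assumes "r \<in> ext_subst nonterminals rules x" "x \<in> A \<union> Z"
  shows "r \<in> lists (A \<union> Z)" "word_eval M val r = val x"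
  using assms val_closed by (auto simp: ext_rules unit_rules_def Pi_def)

lemma sep_rules_sound:
  assumes "r \<in> sep_rules"
  obtains u v where "r = u @ [sep] @ mirror v" "u \<in> lists (A \<union> Z)" "v \<in> lists (A \<union> Z)"
    "word_eval M val u = word_eval M val v"
proof -
  consider u v where "r = u @ [sep] @ mirror v" "u \<in> lists Z" "v \<in> lists Z"
    "word_eval M val u = word_eval M val v" | a where "a \<in> A" "r = [a, sep, a]"
    using assms unfolding sep_rules_def by blast
  then show ?thesis
  proof cases
    case 1
    then show ?thesis using that[OF 1(1)] lists_Z_le by blast
  next
    case 2
    then show ?thesis using that[of "[a]" "[a]"] by (simp add: bar_simps)
  qed
qed

text \<open>Having the same value on both sides of the separator is an invariant. The cases are
  whether the rewritten letter is the separator or lies to its left or to its right; the last is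
  read back through \<open>mirror\<close>.\<close>

lemma derives_sound:
  assumes "derives\<^sub>M w0 w" "w0 = [sep]"
  shows "\<exists>s t. s \<in> lists (A \<union> Z) \<and> t \<in> lists (A \<union> Z) \<and> w = s @ [sep] @ mirror t \<and>
    word_eval M val s = word_eval M val t"
  using assms
proof (induction rule: derives.induct)
  case (derives_refl w)
  then show ?case by (intro exI[of _ "[]"]) simp
next
  case (derives_step w x a y r)
  then obtain s t where st: "s \<in> lists (A \<union> Z)" "t \<in> lists (A \<union> Z)"
    "x @ [a] @ y = s @ [sep] @ mirror t" "word_eval M val s = word_eval M val t" by blast
  from st(3) show ?case
  proof (cases rule: insert_eq_cases)
    case centre
    then obtain u v where uv: "r = u @ [sep] @ mirror v" "u \<in> lists (A \<union> Z)" "v \<in> lists (A \<union> Z)"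
      "word_eval M val u = word_eval M val v"
      using sep_rules_sound derives_step(2) ext_rules(1) by metis
    have "x @ r @ y = (s @ u) @ [sep] @ mirror (t @ v)"
      using centre uv(1) by simp
    moreover have "word_eval M val (s @ u) = word_eval M val (t @ v)"
      using st uv by (simp add: eval_val_append del: in_lists_conv_set)
    ultimately show ?thesis
      using st uv by (intro exI[of _ "s @ u"] exI[of _ "t @ v"] conjI) simp_all
  next
    case (left g)
    have r: "r \<in> lists (A \<union> Z)" "word_eval M val r = val a"
      using ext_rules_sound[OF derives_step(2)] st(1) left(1) by auto
    have "x @ r @ y = (x @ r @ g) @ [sep] @ mirror t" using left by simp
    moreover have xg: "x \<in> lists (A \<union> Z)" "g \<in> lists (A \<union> Z)" "[a] \<in> lists (A \<union> Z)"
      using st(1) left(1) by auto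
    moreover have "word_eval M val (x @ r @ g) = word_eval M val t"
      using st(4) unfolding left(1) using xg r eval_val_append[of x "r @ g"] eval_val_append[of r g]
        eval_val_append[of x "a # g"] by simp
    ultimately show ?thesis
      using r st(2) by (intro exI[of _ "x @ r @ g"] exI[of _ t] conjI) simp_all
  next
    case (right g)
    then obtain g' b y' where t: "t = y' @ [b] @ g'" "g = mirror g'" "a = bar b" "y = mirror y'"
      using mirror_split by metis
    have yg: "y' \<in> lists (A \<union> Z)" "g' \<in> lists (A \<union> Z)" "b \<in> A \<union> Z"
      using st(2) t(1) by auto
    obtain r' where r': "r = mirror r'" "r' \<in> ext_subst nonterminals rules b"
      using derives_step(2) ext_rules_bar[OF yg(3)] unfolding t(3) by auto
    note r = ext_rules_sound[OF r'(2) yg(3)]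
    have "x @ r @ y = s @ [sep] @ mirror (y' @ r' @ g')" using right t r' by simp
    moreover have "word_eval M val (y' @ r' @ g') = word_eval M val s"
      using st(4) unfolding t(1) using yg r eval_val_append[of y' "r' @ g'"]
        eval_val_append[of r' g'] eval_val_append[of y' "b # g'"] by simp
    ultimately show ?thesis
      using r(1) yg st(1) by (intro exI[of _ s] exI[of _ "y' @ r' @ g'"] conjI) simp_all
  qed
qed

section \<open>Completeness of the grammar: reductions read backwards\<close>

lemma derives_mirror:
  assumes "derives\<^sub>M s t" "s \<in> lists (A \<union> Z)"
  shows "t \<in> lists (A \<union> Z) \<and> derives\<^sub>M (mirror s) (mirror t)"
  using assms
proof (induction rule: derives.induct)
  case (derives_step w x a y r)
  then have a: "a \<in> A \<union> Z" by auto
  have "mirror r \<in> ext_subst nonterminals rules (bar a)"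
    using derives_step(2) ext_rules_bar[OF a] by simp
  moreover have "derives\<^sub>M (mirror w) (mirror y @ [bar a] @ mirror x)"
    using derives_step by simp
  ultimately have "derives\<^sub>M (mirror w) (mirror y @ mirror r @ mirror x)"
    by (rule derives.derives_step[rotated])
  then show ?case using derives_step ext_rules_sound(1)[OF _ a] by auto
qed (auto intro: derives.derives_refl)

text \<open>A lift writes each unit letter, possibly not a small unit, as a word over
  \<open>Z\<close> of the same value. Words of value \<open>\<one>\<close> may be interspersed:
  reduction deletes factors of value \<open>\<one>\<close>, and the grammar needs a nonterminal
  there to regenerate them.\<close>

inductive lifts :: "(nat + 'm) list \<Rightarrow> nat list \<Rightarrow> bool" where
  lifts_Nil: "u \<in> lists Z \<Longrightarrow> word_eval M val u = \<one> \<Longrightarrow> lifts [] u"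
| lifts_letter: "u \<in> lists Z \<Longrightarrow> word_eval M val u = \<one> \<Longrightarrow> a \<in> A \<Longrightarrow> lifts s x \<Longrightarrow>
    lifts (Inl a # s) (u @ [a] @ x)"
| lifts_unit: "u \<in> lists Z \<Longrightarrow> word_eval M val u = g \<Longrightarrow> lifts s x \<Longrightarrow> lifts (Inr g # s) (u @ x)"

inductive_cases lifts_NilE: "lifts [] y"
inductive_cases lifts_InlE: "lifts (Inl a # s) y"
inductive_cases lifts_InrE: "lifts (Inr g # s) y"

lemma lifts_in_lists: "lifts s x \<Longrightarrow> x \<in> lists (A \<union> Z)"
  by (induction rule: lifts.induct) auto

lemma lifts_Nil_append:
  assumes "lifts s x" "u \<in> lists Z" "word_eval M val u = \<one>"
  shows "lifts s (u @ x)"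
  using assms(1)
proof cases
  case lifts_Nil
  then show ?thesis
    unfolding lifts_Nil(1)
    using assms eval_val_append[OF lists_Z_le lists_Z_le, of u x] by (intro lifts.lifts_Nil) auto
next
  case (lifts_letter v a s' x')
  then have "lifts (Inl a # s') ((u @ v) @ [a] @ x')"
    using assms eval_val_append[of u v] by (intro lifts.lifts_letter) auto
  with lifts_letter show ?thesis by simp
next
  case (lifts_unit v g s' x')
  then have "lifts (Inr g # s') ((u @ v) @ x')"
    using assms eval_val_append[of u v] eval_val_closed[of v] by (intro lifts.lifts_unit) auto
  with lifts_unit show ?thesis by simp
qed

lemma lifts_append:
  assumes "lifts s x" "lifts s' x'"
  shows "lifts (s @ s') (x @ x')"
  using assms(1)
proof induction
  case (lifts_Nil u)
  then show ?case using lifts_Nil_append[OF assms(2)] by simp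
next
  case (lifts_letter u a s x)
  then show ?case using lifts.lifts_letter[of u a "s @ s'" "x @ x'"] by simp
next
  case (lifts_unit u g s x)
  then show ?case using lifts.lifts_unit[of u g "s @ s'" "x @ x'"] by simp
qed

lemma lifts_split:
  "lifts (s @ s') x \<Longrightarrow> \<exists>y y'. x = y @ y' \<and> lifts s y \<and> lifts s' y'"
proof (induction s arbitrary: x)
  case Nil
  then show ?case using lifts.lifts_Nil[of "[]"] by (intro exI[of _ "[]"] exI[of _ x]) simp
next
  case (Cons c s)
  then have "lifts (c # (s @ s')) x" by simp
  then show ?case
  proof cases
    case (lifts_letter u a x0)
    with Cons.IH[of x0] obtain y y' where "x0 = y @ y'" "lifts s y" "lifts s' y'" by blast
    with lifts_letter show ?thesis
      using lifts.lifts_letter[of u a s y]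
      by (intro exI[of _ "u @ [a] @ y"] exI[of _ y']) simp
  next
    case (lifts_unit u g x0)
    with Cons.IH[of x0] obtain y y' where "x0 = y @ y'" "lifts s y" "lifts s' y'" by blast
    with lifts_unit show ?thesis
      using lifts.lifts_unit[of u g s y]
      by (intro exI[of _ "u @ y"] exI[of _ y']) simp
  qed
qed

lemma lifts_map_Inl: "u \<in> lists A \<Longrightarrow> lifts (map Inl u) u"
proof (induction u)
  case (Cons a u)
  then show ?case using lifts.lifts_letter[of "[]" a "map Inl u" u] by simp
qed (auto intro: lifts.lifts_Nil)

lemma lifts_units:
  "lifts s x \<Longrightarrow> s \<in> lists (range Inr) \<Longrightarrow> x \<in> lists Z \<and> word_eval M val x = ev s"
proof (induction rule: lifts.induct)
  case (lifts_unit u g s x)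
  then show ?case using eval_val_append[of u x] by auto
qed auto

lemma lifts_canon:
  assumes "u \<in> lists Z" "word_eval M val u = ev s"
  shows "lifts (canon s) u"
  using assms lifts_unit[of u "ev s" "[]" "[]"] lifts_Nil[of u] lifts_Nil[of "[]"]
  by (simp add: canon_def)

text \<open>The interspersed letters \<open>code \<one>\<close> generate the words of value
  \<open>\<one>\<close> that a lift may contain, so a single word \<open>pad s\<close> derives every
  lift of \<open>s\<close>.\<close>

primrec pad :: "(nat + 'm) list \<Rightarrow> nat list" where
  "pad [] = [code \<one>]"
| "pad (c # s) = code \<one> # case_sum id code c # pad s"

lemma length_pad: "length (pad s) = 2 * length s + 1"
  by (induction s) auto

lemma pad_sound:
  "s \<in> lists (A <+> small_units) \<Longrightarrow> pad s \<in> lists (A \<union> Z) \<and> word_eval M val (pad s) = ev s"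
proof (induction s)
  case (Cons c s)
  then have s: "pad s \<in> lists (A \<union> Z)" "word_eval M val (pad s) = ev s" by auto
  have "s \<in> unit_words"
    using Cons.prems small_units_subset unfolding unit_words_def by auto
  then have "ev s \<in> carrier M" by simp
  moreover have "case_sum p id c \<in> carrier M" "case_sum id code c \<in> A \<union> Z"
    "val (case_sum id code c) = case_sum p id c"
    using Cons.prems p small_units_closed by (auto simp: val_code code_in_Z val_A)
  moreover have "ev (c # s) = case_sum p id c \<otimes> ev s" by (simp add: ev_def)
  ultimately show ?case
    using s one_small_unit by (simp add: code_in_Z val_code)
qed (use one_small_unit in \<open>simp add: code_in_Z val_code\<close>)

lemma derives_code:
  "g \<in> small_units \<Longrightarrow> u \<in> lists Z \<Longrightarrow> word_eval M val u = g \<Longrightarrow> derives\<^sub>M [code g] u"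
  by (rule derives_letter) (simp add: ext_rules code_in_Z unit_rules_def val_code)

lemma derives_pad:
  "lifts s x \<Longrightarrow> s \<in> lists (A <+> small_units) \<Longrightarrow> derives\<^sub>M (pad s) x"
proof (induction rule: lifts.induct)
  case (lifts_Nil u)
  then show ?case using derives_code[OF one_small_unit] by simp
next
  case (lifts_letter u a s x)
  then have "derives\<^sub>M ([code \<one>] @ [a] @ pad s) (u @ [a] @ x)"
    by (intro derives_append derives_code one_small_unit derives_refl) auto
  then show ?case by simp
next
  case (lifts_unit u g s x)
  then have "derives\<^sub>M ([code \<one>] @ [code g] @ pad s) ([] @ u @ x)"
    by (intro derives_append derives_code one_small_unit) auto
  then show ?case by simp
qed

lemma contracts_letters:
  "contracts s t \<Longrightarrow> length t \<le> bound \<Longrightarrow> s \<in> lists (A <+> small_units)"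
proof (induction rule: contracts.induct)
  case (contracts_unit v s t)
  then have "word_eval M p v \<in> small_units" by (auto simp: small_units_def)
  with contracts_unit show ?case by auto
qed auto

text \<open>If \<open>l\<close> has only unit letters, its lift is a word over \<open>Z\<close> of
  the right value and already lifts \<open>canon l\<close>. Otherwise the value of \<open>l\<close>
  is a small unit, and its code derives \<open>pad l\<close> and then every lift of
  \<open>l\<close>.\<close>

lemma lifts_redex:
  assumes "l \<in> redexes" "lifts l y"
  shows "\<exists>y'. lifts (canon l) y' \<and> derives\<^sub>M y' y"
proof (cases "l \<in> lists (range Inr)")
  case True
  then have "lifts (canon l) y" using lifts_units[OF assms(2)] by (intro lifts_canon) auto
  then show ?thesis using derives_refl by blast
next
  case False
  then obtain t where t: "length t \<le> bound" "contracts l t"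
    using assms(1) unfolding redexes_def by blast
  note contr = contractsD[OF t(2)] and letters = contracts_letters[OF t(2) t(1)]
  have e: "ev l \<in> small_units"
    using redexesD(2)[OF assms(1)] contr t(1) by (auto simp: small_units_def)
  then have "ev l \<in> carrier M" by (rule small_units_closed)
  then have "lifts (canon l) [code (ev l)]"
    using e by (intro lifts_canon) (simp_all add: code_in_Z val_code)
  moreover have "pad l \<in> unit_rules (code (ev l))"
    using pad_sound[OF letters] length_pad[of l] contr(4) t(1) e
    by (simp add: unit_rules_def val_code del: in_lists_conv_set)
  then have "derives\<^sub>M [code (ev l)] (pad l)"
    using e by (intro derives_letter) (simp add: ext_rules code_in_Z)
  then have "derives\<^sub>M [code (ev l)] y"
    using derives_pad[OF assms(2) letters] derives_trans by blast
  ultimately show ?thesis by blast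
qed

lemma lifts_steps:
  "step\<^sup>*\<^sup>* s s' \<Longrightarrow> lifts s x \<Longrightarrow> \<exists>x'. lifts s' x' \<and> derives\<^sub>M x' x"
proof (induction rule: rtranclp_induct)
  case base
  then show ?case using derives_refl by blast
next
  case (step s' s'')
  then obtain x' where x': "lifts s' x'" "derives\<^sub>M x' x" by blast
  obtain u l v where l: "s' = u @ l @ v" "s'' = u @ canon l @ v" "l \<in> redexes"
    using step(2) unfolding step_def by blast
  obtain y1 y where y: "x' = y1 @ y" "lifts u y1" "lifts (l @ v) y"
    using lifts_split x'(1) unfolding l(1) by blast
  then obtain y2 y3 where y2: "y = y2 @ y3" "lifts l y2" "lifts v y3"
    using lifts_split by blast
  obtain z where z: "lifts (canon l) z" "derives\<^sub>M z y2"
    using lifts_redex[OF l(3) y2(2)] by blast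
  have "lifts s'' (y1 @ z @ y3)"
    unfolding l(2) by (intro lifts_append y z y2)
  moreover have "derives\<^sub>M (y1 @ z @ y3) x'"
    unfolding y(1) y2(1) by (intro derives_append derives_refl z)
  ultimately show ?case using x'(2) derives_trans by blast
qed

lemma derives_sep:
  assumes "u \<in> lists Z" "v \<in> lists Z" "word_eval M val u = word_eval M val v"
    and "derives\<^sub>M [sep] w"
  shows "derives\<^sub>M [sep] (u @ w @ mirror v)"
proof (rule derives_trans)
  show "derives\<^sub>M (u @ [sep] @ mirror v) (u @ w @ mirror v)"
    by (rule derives_context[OF assms(4)])
  show "derives\<^sub>M [sep] (u @ [sep] @ mirror v)"
    using assms by (intro derives_letter) (auto simp: ext_rules sep_rules_def)
qed

text \<open>Two lifts of the same word are generated from the outside inwards: corresponding blocks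
  over \<open>Z\<close> have equal values and come from one separator rule, and a common letter
  \<open>a\<close> comes from \<open>[a, sep, a]\<close>.\<close>

lemma derives_lifts_pair:
  "lifts s x \<Longrightarrow> lifts s y \<Longrightarrow> derives\<^sub>M [sep] (x @ [sep] @ mirror y)"
proof (induction arbitrary: y rule: lifts.induct)
  case (lifts_Nil u)
  from lifts_Nil(3) have "y \<in> lists Z" "word_eval M val y = \<one>" by (auto elim: lifts_NilE)
  then show ?case
    using lifts_Nil by (intro derives_sep derives_refl) auto
next
  case (lifts_letter u a s x)
  from lifts_letter(6) obtain v y' where y: "y = v @ a # y'" "v \<in> lists Z" "word_eval M val v = \<one>"
    "lifts s y'" by (rule lifts_InlE)
  have "derives\<^sub>M [sep] ([a] @ [sep] @ [a])"
    using lifts_letter(3) by (intro derives_letter) (auto simp: ext_rules sep_rules_def)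
  then have "derives\<^sub>M [sep] ([a] @ (x @ [sep] @ mirror y') @ [a])"
    using lifts_letter(5)[OF y(4)] derives_context derives_trans by blast
  then have "derives\<^sub>M [sep] (u @ ([a] @ (x @ [sep] @ mirror y') @ [a]) @ mirror v)"
    using lifts_letter y by (intro derives_sep) auto
  then show ?case using y(1) lifts_letter(3) by (simp add: bar_simps)
next
  case (lifts_unit u g s x)
  from lifts_unit(5) obtain v y' where y: "y = v @ y'" "v \<in> lists Z" "word_eval M val v = g"
    "lifts s y'" by (rule lifts_InrE)
  then have "derives\<^sub>M [sep] (u @ (x @ [sep] @ mirror y') @ mirror v)"
    using lifts_unit(1,2,4) by (intro derives_sep[OF _ y(2)]) simp_all
  then show ?case using y(1) by simp
qed

text \<open>Both words reduce to a common \<open>s\<close>. Lifting the two reductions gives two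
  lifts of \<open>s\<close>, which the separator generates as a pair; each side then derives its own
  word.\<close>

lemma derives_word_problem:
  assumes "u \<in> lists A" "v \<in> lists A" "word_eval M p u = word_eval M p v"
  shows "derives\<^sub>M [sep] (u @ [sep] @ rev v)"
proof -
  obtain s where s: "step\<^sup>*\<^sup>* (map Inl u) s" "step\<^sup>*\<^sup>* (map Inl v) s"
    using joinable_if_eval_eq[OF assms] unfolding joinable_def by blast
  obtain x where x: "lifts s x" "derives\<^sub>M x u"
    using lifts_steps[OF s(1) lifts_map_Inl] assms by blast
  obtain y where y: "lifts s y" "derives\<^sub>M y v"
    using lifts_steps[OF s(2) lifts_map_Inl] assms by blast
  have "derives\<^sub>M (mirror y) (mirror v)"
    using derives_mirror[OF y(2) lifts_in_lists[OF y(1)]] by blast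
  then have "derives\<^sub>M (x @ [sep] @ mirror y) (u @ [sep] @ rev v)"
    using x(2) unfolding mirror_A[OF assms(2)] by (intro derives_append derives_refl)
  then show ?thesis
    using derives_lifts_pair[OF x(1) y(1)] derives_trans by blast
qed

lemma word_problem_eq_derives:
  "word_problem M A p sep =
    {w. derives\<^sub>M [sep] w} \<inter> {u @ [sep] @ v | u v. u \<in> lists A \<and> v \<in> lists A}"
proof (intro equalityI subsetI)
  fix w assume "w \<in> word_problem M A p sep"
  then obtain u v where "w = u @ [sep] @ rev v" "u \<in> lists A" "v \<in> lists A"
    "word_eval M p u = word_eval M p v"
    by (auto simp: word_problem_def)
  moreover from this have "rev v \<in> lists A" by auto
  ultimately show "w \<in> {w. derives\<^sub>M [sep] w} \<inter> {u @ [sep] @ v | u v. u \<in> lists A \<and> v \<in> lists A}"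
    using derives_word_problem by blast
next
  fix w assume "w \<in> {w. derives\<^sub>M [sep] w} \<inter> {u @ [sep] @ v | u v. u \<in> lists A \<and> v \<in> lists A}"
  then obtain u v where w: "derives\<^sub>M [sep] w" "w = u @ [sep] @ v" "u \<in> lists A" "v \<in> lists A"
    by blast
  obtain s t where st: "s \<in> lists (A \<union> Z)" "t \<in> lists (A \<union> Z)" "w = s @ [sep] @ mirror t"
    "word_eval M val s = word_eval M val t"
    using derives_sound[OF w(1)] by blast
  have "u = s \<and> v = mirror t"
    using w st Z_disjoint sep_notin_mirror[OF st(2)] by (intro separated_eq_iff[THEN iffD1]) auto
  then have "s \<in> lists A" "t \<in> lists A"
    using w mirror_in_lists_A[of t] by auto
  then show "w \<in> word_problem M A p sep"
    using st mirror_A[of t] eval_val_A unfolding word_problem_def by auto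
qed

section \<open>Finite generation of the group of units\<close>

lemma eval_units_of [simp]: "word_eval (units_of M) q w = word_eval M q w"
  by (simp add: word_eval_def units_of_def)

lemma generating_map_units: "generating_map (units_of M) Z val"
  unfolding generating_map_def
proof
  show "val \<in> Z \<rightarrow> carrier (units_of M)"
    using val_Z by (simp add: units_of_def)
  show "word_eval (units_of M) val ` lists Z = carrier (units_of M)"
  proof (intro equalityI subsetI)
    fix g assume "g \<in> carrier (units_of M)"
    then have g: "g \<in> Units M" by (simp add: units_of_def)
    then obtain v where v: "v \<in> lists A" "word_eval M p v = g"
      using generates Units_closed by (metis imageE)
    \<comment> \<open>The word \<open>v\<close> lifts itself. Its reduction to canonical form
      therefore produces a lift of at most one unit letter, which is a word over \<open>Z\<close>
      with value \<open>g\<close>.\<close>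
    obtain x where x: "lifts (canon (map Inl v)) x"
      using lifts_steps[OF unit_reduces_to_canon lifts_map_Inl] v g by blast
    have "ev (map Inl v) = g" using v by simp
    then have "x \<in> lists Z" "word_eval M val x = g"
      using lifts_units[OF x] g by (auto simp: canon_def split: if_splits)
    then show "g \<in> word_eval (units_of M) val ` lists Z" by auto
  qed (use eval_val_Z in \<open>auto simp: units_of_carrier\<close>)
qed

end

section \<open>The word problem\<close>

lemma fp_special_monoid_presentation:
  fixes M :: "('m, 'b) monoid_scheme"
  assumes "fp_special_monoid M"
  shows "\<exists>A W p. special_presentation M A W p"
proof -
  interpret monoid M using assms by (simp add: fp_special_monoid_def)
  obtain A :: "nat set" and W where AW: "finite A" "finite W" "W \<subseteq> lists A"
    "M \<cong> presented_monoid A (W \<times> {[]})"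
    using assms unfolding fp_special_monoid_def by blast
  define R where "R = pres_cong A (W \<times> {[]})"
  let ?P = "presented_monoid A (W \<times> {[]})"
  obtain f where f: "f \<in> hom M ?P" "bij_betw f (carrier M) (carrier ?P)"
    using AW(4) unfolding is_iso_def iso_def by blast
  have carr: "carrier ?P = lists A // R" and one: "\<one>\<^bsub>?P\<^esub> = R `` {[]}"
    by (simp_all add: presented_monoid_def R_def)
  have cls: "R `` {u} \<in> carrier ?P" if "u \<in> lists A" for u
    unfolding carr using that by (rule quotientI)
  define p where "p a = inv_into (carrier M) f (R `` {[a]})" for a
  have p: "p a \<in> carrier M" "f (p a) = R `` {[a]}" if "a \<in> A" for a
    using cls[of "[a]"] that f(2) unfolding p_def
    by (auto simp: bij_betw_def inv_into_into f_inv_into_f)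
  have pA: "p \<in> A \<rightarrow> carrier M" using p by blast
  interpret P: monoid ?P by (rule monoid_presented_monoid)
  \<comment> \<open>Membership in \<open>hom\<close> does not include preservation of the identity;
    it follows from surjectivity.\<close>
  have f1: "f \<one>\<^bsub>M\<^esub> = \<one>\<^bsub>?P\<^esub>"
  proof -
    obtain e where e: "e \<in> carrier M" "f e = \<one>\<^bsub>?P\<^esub>"
      using f(2) P.one_closed unfolding bij_betw_def by (metis imageE)
    then have "f \<one>\<^bsub>M\<^esub> = f \<one>\<^bsub>M\<^esub> \<otimes>\<^bsub>?P\<^esub> f e"
      using f(1) by (simp add: hom_in_carrier)
    also have "\<dots> = f e" using e hom_mult[OF f(1), of "\<one>\<^bsub>M\<^esub>" e] by simp
    finally show ?thesis using e by simp
  qed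
  have ev: "f (word_eval M p u) = R `` {u}" if "u \<in> lists A" for u
    using that
  proof induction
    case (Cons a u)
    then show ?case
      using p word_eval_closed[OF pA Cons(2)] presented_monoid_mult[of "[a]" A u "W \<times> {[]}"]
      by (simp add: hom_mult[OF f(1)] R_def)
  qed (simp add: f1 one)
  have inj: "inj_on f (carrier M)" using f(2) by (simp add: bij_betw_def)
  have eval_eq: "word_eval M p u = word_eval M p v \<longleftrightarrow> (u, v) \<in> R"
    if "u \<in> lists A" "v \<in> lists A" for u v
  proof -
    have "word_eval M p u = word_eval M p v \<longleftrightarrow> R `` {u} = R `` {v}"
      using inj_on_eq_iff[OF inj word_eval_closed[OF pA] word_eval_closed[OF pA], of u v] ev that
      by simp
    then show ?thesis
      using eq_equiv_class_iff[OF equiv_pres_cong, of u A v] that by (simp add: R_def)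
  qed
  have "special_presentation M A W p"
  proof (unfold_locales)
    show "word_eval M p ` lists A = carrier M"
    proof (intro equalityI subsetI)
      fix x assume x: "x \<in> carrier M"
      then have "f x \<in> lists A // R" using f(2) carr by (auto simp: bij_betw_def)
      then obtain u where u: "u \<in> lists A" "f x = R `` {u}" by (auto simp: quotient_def)
      then have "f (word_eval M p u) = f x" using ev by simp
      then have "word_eval M p u = x"
        using inj x word_eval_closed[OF pA u(1)] by (auto dest: inj_onD)
      with u show "x \<in> word_eval M p ` lists A" by blast
    qed (use word_eval_closed[OF pA] in auto)
    show "word_eval M p w = \<one>\<^bsub>M\<^esub>" if "w \<in> W" for w
    proof -
      have "(w, []) \<in> R" unfolding R_def using that AW(3) by (intro pres_cong.rel) auto
      then show ?thesis using eval_eq[of w "[]"] that AW(3) by auto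
    qed
  qed (use AW pA eval_eq in \<open>auto simp: R_def\<close>)
  then show ?thesis by blast
qed

section \<open>Transfer of the word problem in both directions\<close>

context special_presentation
begin

lemma Z_words_over_generators:
  assumes "word_eval M q ` lists B = N" "Units M \<subseteq> N"
  obtains f where "f \<in> Z \<rightarrow> lists B" "\<And>x. x \<in> Z \<Longrightarrow> word_eval M q (f x) = val x"
proof -
  have "\<forall>x\<in>Z. \<exists>u\<in>lists B. word_eval M q u = val x"
    using assms val_Z by (metis imageE subsetD)
  then obtain f where "\<forall>x\<in>Z. f x \<in> lists B \<and> word_eval M q (f x) = val x" by metis
  then show ?thesis using that[of f] by blast
qed

lemma bar_disjoint: "inj_on bar Z" "bar ` Z \<inter> Z = {}" "sep \<notin> bar ` Z"
  using Z_disjoint by (auto simp: bar_simps inj_on_def)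

text \<open>Stated for arbitrary \<open>G\<close> because it is applied with \<open>M\<close> in one
  direction and with \<open>units_of M\<close> in the other.\<close>

lemma mirrored_units_word_problem_in:
  assumes C: "afl C" and wp: "word_problem G B q h \<in> C" "h \<notin> B"
    and f: "f \<in> Z \<rightarrow> lists B"
    and eval: "\<And>u. u \<in> lists Z \<Longrightarrow> word_eval G q (word_hom f u) = word_eval M val u"
  shows "{u @ [sep] @ mirror v | u v. u \<in> lists Z \<and> v \<in> lists Z \<and>
    word_eval M val u = word_eval M val v} \<in> C" (is "?S \<in> C")
proof -
  have "{u @ [sep] @ map bar (rev v) | u v. u \<in> lists Z \<and> v \<in> lists Z \<and>
      word_eval G q (word_hom f u) = word_eval G q (word_hom f v)} \<in> C" (is "?T \<in> C")
    using Z_disjoint bar_disjoint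
    by (intro afl_word_problem_double[OF C wp finite_Z f]) auto
  also have "?T = ?S"
    unfolding mirror_def using eval by (intro Collect_cong ex_cong1 conj_cong HOL.refl) simp
  finally show ?thesis .
qed

lemma units_has_word_problem:
  assumes C: "afl C" and M: "has_word_problem_in M C"
  shows "has_word_problem_in (units_of M) C"
proof -
  obtain B q h where q: "generating_map M B q" "h \<notin> B" "word_problem M B q h \<in> C"
    using M unfolding has_word_problem_in_def by blast
  have qB: "q \<in> B \<rightarrow> carrier M" "word_eval M q ` lists B = carrier M"
    using q(1) by (auto simp: generating_map_def)
  obtain f where f: "f \<in> Z \<rightarrow> lists B" "\<And>x. x \<in> Z \<Longrightarrow> word_eval M q (f x) = val x"
    using Z_words_over_generators[OF qB(2)] by (metis Units_closed subsetI)
  \<comment> \<open>Renaming the copies back turns the mirrored language into the actual word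
    problem over \<open>Z\<close>.\<close>
  define unbar where "unbar x = (if x \<in> bar ` Z then inv_into Z bar x else x)" for x
  have "{u @ [sep] @ mirror v | u v. u \<in> lists Z \<and> v \<in> lists Z \<and>
      word_eval M val u = word_eval M val v} \<in> C" (is "?S \<in> C")
    by (rule mirrored_units_word_problem_in[OF C q(3,2) f(1) word_eval_hom[OF qB(1) f]])
  then have "map unbar ` ?S \<in> C" by (rule afl_map[OF C])
  also have "map unbar ` ?S = word_problem (units_of M) Z val sep"
  proof -
    have "map unbar u = u" "map unbar (mirror u) = rev u" if "u \<in> lists Z" for u
      using that bar_disjoint by (induction u) (auto simp: unbar_def inv_into_f_f)
    then have *: "map unbar (u @ [sep] @ mirror v) = u @ [sep] @ rev v"
      if "u \<in> lists Z" "v \<in> lists Z" for u v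
      using that bar_disjoint(3) by (simp add: unbar_def)
    show ?thesis
    proof (intro equalityI subsetI)
      fix w assume "w \<in> map unbar ` ?S"
      then obtain u v where "w = map unbar (u @ [sep] @ mirror v)" "u \<in> lists Z" "v \<in> lists Z"
        "word_eval M val u = word_eval M val v" by blast
      then show "w \<in> word_problem (units_of M) Z val sep"
        using *[of u v] unfolding word_problem_def eval_units_of by blast
    next
      fix w assume "w \<in> word_problem (units_of M) Z val sep"
      then obtain u v where "w = u @ [sep] @ rev v" "u \<in> lists Z" "v \<in> lists Z"
        "word_eval M val u = word_eval M val v"
        unfolding word_problem_def eval_units_of by blast
      then show "w \<in> map unbar ` ?S"
        using *[of u v] by (intro image_eqI[of _ _ "u @ [sep] @ mirror v"]) auto
    qed
  qed
  finally show ?thesis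
    unfolding has_word_problem_in_def using finite_Z generating_map_units Z_disjoint(2) by blast
qed

lemma has_word_problem_if_units:
  assumes C: "super_afl C" "closed_reversal C" and U: "has_word_problem_in (units_of M) C"
  shows "has_word_problem_in M C"
proof -
  have afl: "afl C" using C(1) by (simp add: super_afl_def)
  obtain B q h where q: "generating_map (units_of M) B q" "h \<notin> B"
      "word_problem (units_of M) B q h \<in> C"
    using U unfolding has_word_problem_in_def by blast
  have qB: "q \<in> B \<rightarrow> carrier M" "word_eval M q ` lists B = Units M"
    using q(1) by (auto simp: generating_map_def units_of_carrier)
  have nonempty: "C \<noteq> {}" using q by blast
  obtain f where f: "f \<in> Z \<rightarrow> lists B" "\<And>x. x \<in> Z \<Longrightarrow> word_eval M q (f x) = val x"
    using Z_words_over_generators[OF qB(2) subset_refl] by metis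
  note eval = word_eval_hom[OF qB(1) f]
  have "sep_rules \<in> C"
    unfolding sep_rules_def
    by (intro afl_Un[OF afl] mirrored_units_word_problem_in[OF afl q(3,2) f(1)]
        afl_finite[OF afl nonempty] finite_imageI finite_A) (simp add: eval)
  moreover have unit_rules: "unit_rules x \<in> C" if "x \<in> Z" for x
  proof -
    have "{u \<in> lists Z. word_eval (units_of M) q (word_hom f u) = word_eval (units_of M) q (f x)} \<in> C"
      using f(1) that by (intro afl_word_problem_fibre[OF afl q(3,2) finite_Z]) auto
    also have "{u \<in> lists Z. word_eval (units_of M) q (word_hom f u) = word_eval (units_of M) q (f x)} =
        {u \<in> lists Z. word_eval M val u = val x}"
      using eval f(2)[OF that] by (intro Collect_cong conj_cong HOL.refl) simp
    finally have "{u \<in> lists Z. word_eval M val u = val x} \<in> C" .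
    moreover have "finite {s \<in> lists (A \<union> Z). length s \<le> 2 * bound + 1 \<and> word_eval M val s = val x}"
      by (rule finite_subset[OF _ finite_lists_length_le[of "A \<union> Z" "2 * bound + 1"]])
        (use finite_A finite_Z in auto)
    ultimately show ?thesis
      unfolding unit_rules_def by (rule afl_Un[OF afl _ afl_finite[OF afl nonempty]])
  qed
  \<comment> \<open>The rules on the right of the separator are the reversed ones; closure under
    reversal enters here.\<close>
  moreover have "mirror ` unit_rules x \<in> C" if "x \<in> Z" for x
  proof -
    have "rev ` unit_rules x \<in> C"
      using C(2) unit_rules[OF that] by (simp add: closed_reversal_def)
    from afl_map[OF afl this] show ?thesis
      by (simp add: image_image mirror_def[abs_def])
  qed
  ultimately have rules: "rules x \<in> C" if "x \<in> nonterminals" for x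
    using that by (auto simp: rules_def)
  have "iterated_subst nonterminals rules {[sep]} \<in> C"
  proof -
    have "nested_subst nonterminals rules"
      unfolding nested_subst_def using ext_rules_refl by blast
    then show ?thesis
      using C(1) rules afl_singleton[OF afl nonempty, of "[sep]"] finite_Z
      unfolding super_afl_def closed_nested_iterated_subst_def by simp
  qed
  \<comment> \<open>Intersecting with this regular language discards words that still contain
    letters of \<open>Z\<close> or their copies.\<close>
  then have "iterated_subst nonterminals rules {[sep]} \<inter>
      {u @ [sep] @ v | u v. u \<in> lists A \<and> v \<in> lists A} \<in> C"
    by (rule afl_Int_regular[OF afl])
      (intro regular_language_separated finite_A Z_disjoint)
  then have "word_problem M A p sep \<in> C"
    unfolding word_problem_eq_derives
      iterated_subst_eq_derives[of nonterminals rules, OF ext_rules_refl] by simp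
  then show ?thesis
    unfolding has_word_problem_in_def generating_map_def
    using finite_A p generates Z_disjoint(1) by blast
qed

end

theorem theorem1:
  fixes M :: "('m, 'b) monoid_scheme"
    and C :: "nat list set set"
  assumes "fp_special_monoid M"
    and "super_afl C"
    and "closed_reversal C"
  shows "has_word_problem_in M C \<longleftrightarrow> has_word_problem_in (units_of M) C"
proof -
  obtain A W p where "special_presentation M A W p"
    using fp_special_monoid_presentation[OF assms(1)] by blast
  then interpret special_presentation M A W p .
  show ?thesis
    using units_has_word_problem has_word_problem_if_units assms(2,3)
    by (auto simp: super_afl_def)
qed

end
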